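(* Let $S\in\mathcal{Q}(\mathcal{K},\Gamma)$. There is a unique Pfaffian point process $M^{S}$ on $\mathfrak{X}$ possessing the following property: for any function $\alpha:\mathfrak{X}\to\mathbb{R}$ such that $\alpha(x)\ge 1$ for all $x\in\mathfrak{X}$ and $\alpha-1$ is finitely supported, $$\int_{\Omega}\Psi_{\alpha}(\omega)\,M^{S}(d\omega)=\mathrm{Pf}\big[\mathbb{J}+\sqrt{\alpha-1}\,\mathbb{K}_{S}\sqrt{\alpha-1}\big]_{\mathfrak{X}}.$$
   Context: $\mathfrak{X}$ is a countable set, $\Omega=\{0,1\}^{\mathfrak{X}}$ carries the product topology and its Borel $\sigma$-algebra $\Sigma$; $\omega\in\Omega$ is identified with the subset $\{x:\omega(x)=1\}$ of $\mathfrak{X}$. For a probability measure $M$ on $(\Omega,\Sigma)$, $\rho^{M}_{n}(x_{1},\dots,x_{n})=M(\{\omega:\omega(x_{1})=\cdots=\omega(x_{n})=1\})$ for distinct points, extended by $0$ when two points coincide. For $\mathbb{K}:\mathfrak{X}\times\mathfrak{X}\to M(2;\mathbb{C})$ with the antisymmetry $\mathbb{K}(x,y)^{\mathrm{T}}=-\mathbb{K}(y,x)$, $[\mathbb{K}(x_{i},x_{j})]_{1\le i,j\le n}$ denotes the antisymmetric $2n\times 2n$ matrix whose $(i,j)$-th $2\times 2$ block is $\mathbb{K}(x_{i},x_{j})$, with Pfaffian $\mathrm{Pf}$; for a finite subset $X\subset\mathfrak{X}$, $\mathrm{Pf}[\mathbb{K}(x,y)]_{x,y\in X}$ is this Pfaffian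 for any enumeration of $X$ (it does not depend on the enumeration). $M$ is a Pfaffian point process on $\mathfrak{X}$ if there is such a $\mathbb{K}$ with $\rho^{M}_{n}(x_{1},\dots,x_{n})=\mathrm{Pf}[\mathbb{K}(x_{i},x_{j})]_{1\le i,j\le n}$ for all $n\in\mathbb{N}$. $e_{x}\in\ell^{2}(\mathfrak{X})$ is $e_{x}(y)=\delta_{x,y}$; inner products are linear in the second argument; $J$ is the antilinear complex conjugation on $\ell^{2}(\mathfrak{X})$ fixing each $e_{x}$; $\mathcal{K}=\ell^{2}(\mathfrak{X})\oplus\ell^{2}(\mathfrak{X})$ and $\Gamma=\begin{pmatrix}0 & J\\ J & 0\end{pmatrix}$; $\overline{A}:=\Gamma A\Gamma$. $\mathcal{Q}(\mathcal{K},\Gamma)=\{S\text{ bounded on }\mathcal{K}:0\le S=S^{\ast}\le 1,\ \overline{S}=1-S\}$. For $S=\begin{pmatrix}S_{11}&S_{12}\\ S_{21}&S_{22}\end{pmatrix}\in\mathcal{Q}(\mathcal{K},\Gamma)$, $$\mathbb{K}_{S}(x,y)=\begin{pmatrix}(e_{x},S_{21}e_{y}) & (e_{x},S_{22}e_{y})\\ (e_{x},(S_{11}-1)e_{y}) & (e_{x},S_{12}e_{y})\end{pmatrix},$$ which has the antisymmetry $\mathbb{K}_{S}(x,y)^{\mathrm{T}}=-\mathbb{K}_{S}(y,x)$. $\Psi_{\alpha}(\omega)=\prod_{x\in\omega}\alpha(x)$ (a finite product up to factors equal to $1$). $(\sqrt{\alpha-1}\,\mathbb{K}\sqrt{\alpha-1})(x,y):=\sqrt{\alpha(x)-1}\,\mathbb{K}(x,y)\sqrt{\alpha(y)-1}$.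 $\mathbb{J}(x,y)=\delta_{x,y}\begin{pmatrix}0&1\\-1&0\end{pmatrix}$. For a finitely supported antisymmetric $\mathbb{K}$, the Fredholm Pfaffian is $\mathrm{Pf}[\mathbb{J}+\mathbb{K}]_{\mathfrak{X}}:=1+\sum_{X}\mathrm{Pf}[\mathbb{K}(x,y)]_{x,y\in X}$, the sum being over non-empty finite subsets $X\subset\mathfrak{X}$ (only finitely many terms are non-zero). *)

theory Defs
  imports
    "HOL-Probability.Probability"
    "HOL-Combinatorics.Permutations"
    "HOL-Library.Function_Algebras"
begin

section \<open>The Hilbert space and its conjugation\<close>

text \<open>
  The countable set of sites is a type \<open>'x :: countable\<close>.  Vectors are plain functions; the Hilbert
  spaces are the carrier sets \<open>ell2\<close> and \<open>hilb\<close>.  An operator is a HOL function whose values outside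
  \<open>hilb\<close> are irrelevant.  Sums, differences and the zero vector are pointwise.
\<close>

type_synonym 'x dbl = "('x \<Rightarrow> complex) \<times> ('x \<Rightarrow> complex)"

definition ell2 :: "('x \<Rightarrow> complex) set" where
  "ell2 = {f. (\<lambda>x. (cmod (f x))\<^sup>2) summable_on UNIV}"

definition ell2_inner :: "('x \<Rightarrow> complex) \<Rightarrow> ('x \<Rightarrow> complex) \<Rightarrow> complex" where
  "ell2_inner f g = (\<Sum>\<^sub>\<infinity>x. cnj (f x) * g x)"

definition basis_vec :: "'x \<Rightarrow> 'x \<Rightarrow> complex" where
  "basis_vec x = (\<lambda>y. if x = y then 1 else 0)"

definition conj_J :: "('x \<Rightarrow> complex) \<Rightarrow> ('x \<Rightarrow> complex)" where
  "conj_J f = (\<lambda>x. cnj (f x))"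

definition hilb :: "'x dbl set" where
  "hilb = ell2 \<times> ell2"

definition hilb_inner :: "'x dbl \<Rightarrow> 'x dbl \<Rightarrow> complex" where
  "hilb_inner u v = ell2_inner (fst u) (fst v) + ell2_inner (snd u) (snd v)"

definition hilb_norm :: "'x dbl \<Rightarrow> real" where
  "hilb_norm u = sqrt (Re (hilb_inner u u))"

definition hilb_scale :: "complex \<Rightarrow> 'x dbl \<Rightarrow> 'x dbl" where
  "hilb_scale c u = ((\<lambda>x. c * fst u x), (\<lambda>x. c * snd u x))"

definition Gam :: "'x dbl \<Rightarrow> 'x dbl" where
  "Gam u = (conj_J (snd u), conj_J (fst u))"


section \<open>Bounded operators and the set of covariance operators\<close>

definition bounded_operator :: "('x dbl \<Rightarrow> 'x dbl) \<Rightarrow> bool" where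
  "bounded_operator T \<longleftrightarrow>
     (\<forall>u\<in>hilb. T u \<in> hilb) \<and>
     (\<forall>u\<in>hilb. \<forall>v\<in>hilb. T (u + v) = T u + T v) \<and>
     (\<forall>c. \<forall>u\<in>hilb. T (hilb_scale c u) = hilb_scale c (T u)) \<and>
     (\<exists>C. \<forall>u\<in>hilb. hilb_norm (T u) \<le> C * hilb_norm u)"

definition self_adjoint :: "('x dbl \<Rightarrow> 'x dbl) \<Rightarrow> bool" where
  "self_adjoint T \<longleftrightarrow> (\<forall>u\<in>hilb. \<forall>v\<in>hilb. hilb_inner (T u) v = hilb_inner u (T v))"

definition operator_le :: "('x dbl \<Rightarrow> 'x dbl) \<Rightarrow> ('x dbl \<Rightarrow> 'x dbl) \<Rightarrow> bool" where
  "operator_le A B \<longleftrightarrow> (\<forall>u\<in>hilb. hilb_inner u (B u - A u) \<in> \<real>\<^sub>\<ge>\<^sub>0)"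

definition bar :: "('x dbl \<Rightarrow> 'x dbl) \<Rightarrow> ('x dbl \<Rightarrow> 'x dbl)" where
  "bar A = (\<lambda>u. Gam (A (Gam u)))"

definition covariances :: "('x dbl \<Rightarrow> 'x dbl) set" where
  "covariances = {S. bounded_operator S \<and> self_adjoint S \<and>
     operator_le (\<lambda>u. 0) S \<and> operator_le S (\<lambda>u. u) \<and>
     (\<forall>u\<in>hilb. bar S u = u - S u)}"

definition blk11 :: "('x dbl \<Rightarrow> 'x dbl) \<Rightarrow> ('x \<Rightarrow> complex) \<Rightarrow> ('x \<Rightarrow> complex)" where
  "blk11 S f = fst (S (f, 0))"

definition blk12 :: "('x dbl \<Rightarrow> 'x dbl) \<Rightarrow> ('x \<Rightarrow> complex) \<Rightarrow> ('x \<Rightarrow> complex)" where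
  "blk12 S f = fst (S (0, f))"

definition blk21 :: "('x dbl \<Rightarrow> 'x dbl) \<Rightarrow> ('x \<Rightarrow> complex) \<Rightarrow> ('x \<Rightarrow> complex)" where
  "blk21 S f = snd (S (f, 0))"

definition blk22 :: "('x dbl \<Rightarrow> 'x dbl) \<Rightarrow> ('x \<Rightarrow> complex) \<Rightarrow> ('x \<Rightarrow> complex)" where
  "blk22 S f = snd (S (0, f))"


section \<open>Matrix-valued kernels and Pfaffians\<close>

type_synonym 'x kernel = "'x \<Rightarrow> 'x \<Rightarrow> complex^2^2"

definition antisymmetric_kernel :: "'x kernel \<Rightarrow> bool" where
  "antisymmetric_kernel K \<longleftrightarrow> (\<forall>x y. transpose (K x y) = - K y x)"

definition kernel_of :: "('x dbl \<Rightarrow> 'x dbl) \<Rightarrow> 'x kernel" where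
  "kernel_of S x y = vector
     [vector [ell2_inner (basis_vec x) (blk21 S (basis_vec y)),
              ell2_inner (basis_vec x) (blk22 S (basis_vec y))],
      vector [ell2_inner (basis_vec x) (blk11 S (basis_vec y) - basis_vec y),
              ell2_inner (basis_vec x) (blk12 S (basis_vec y))]]"

text \<open>
  The Pfaffian of the antisymmetric matrix with entries \<open>A i j\<close>, where rows and columns are indexed by
  \<open>{0..<2 * n}\<close>:
  \<open>Pf A = 1 / (2^n n!) \<Sum>\<^sub>p sgn p \<Prod>\<^sub>i A (p (2i)) (p (2i+1))\<close>.
\<close>
definition pfaffian :: "nat \<Rightarrow> (nat \<Rightarrow> nat \<Rightarrow> complex) \<Rightarrow> complex" where
  "pfaffian n A =
     (\<Sum>p | p permutes {..<2 * n}. of_int (sign p) * (\<Prod>i<n. A (p (2 * i)) (p (2 * i + 1))))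
       / (2 ^ n * fact n)"

text \<open>Row \<open>2i\<close> (resp. \<open>2i+1\<close>) is the first (resp. second) row of the blocks belonging to \<open>xs ! i\<close>.\<close>
definition block_matrix :: "'x kernel \<Rightarrow> 'x list \<Rightarrow> nat \<Rightarrow> nat \<Rightarrow> complex" where
  "block_matrix K xs i j =
     K (xs ! (i div 2)) (xs ! (j div 2)) $ (if even i then 1 else 2) $ (if even j then 1 else 2)"

definition pf_list :: "'x kernel \<Rightarrow> 'x list \<Rightarrow> complex" where
  "pf_list K xs = pfaffian (length xs) (block_matrix K xs)"

text \<open>For finite \<open>X\<close> and antisymmetric \<open>K\<close> the value does not depend on the chosen enumeration.\<close>
definition pf_set :: "'x kernel \<Rightarrow> 'x set \<Rightarrow> complex" where
  "pf_set K X = pf_list K (SOME xs. distinct xs \<and> set xs = X)"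

text \<open>
  The Fredholm Pfaffian \<open>Pf[J + K]\<close>; for finitely supported \<open>K\<close> only finitely many summands are
  non-zero, so the unordered sum is a finite one.
\<close>
definition fredholm_pfaffian :: "'x kernel \<Rightarrow> complex" where
  "fredholm_pfaffian K = 1 + (\<Sum>\<^sub>\<infinity>X\<in>{X. finite X \<and> X \<noteq> {}}. pf_set K X)"

definition sandwich :: "('x \<Rightarrow> real) \<Rightarrow> 'x kernel \<Rightarrow> 'x kernel" where
  "sandwich \<alpha> K = (\<lambda>x y. (sqrt (\<alpha> x - 1) * sqrt (\<alpha> y - 1)) *\<^sub>R K x y)"


section \<open>Point processes\<close>

text \<open>
  A configuration is a function \<open>\<omega> :: 'x \<Rightarrow> bool\<close>, where \<open>True\<close> stands for an occupied site;
  \<open>borel\<close> on this type belongs to the product of the discrete topologies on \<open>bool\<close>.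
\<close>
definition point_process :: "('x \<Rightarrow> bool) measure \<Rightarrow> bool" where
  "point_process M \<longleftrightarrow> prob_space M \<and> sets M = sets borel"

definition correlation :: "('x \<Rightarrow> bool) measure \<Rightarrow> 'x list \<Rightarrow> real" where
  "correlation M xs =
     (if distinct xs then measure M {\<omega>. \<forall>x\<in>set xs. \<omega> x} else 0)"

definition pfaffian_point_process :: "('x \<Rightarrow> bool) measure \<Rightarrow> bool" where
  "pfaffian_point_process M \<longleftrightarrow> point_process M \<and>
     (\<exists>K. antisymmetric_kernel K \<and> (\<forall>xs. complex_of_real (correlation M xs) = pf_list K xs))"

text \<open>
  The product over the occupied sites with the factors equal to \<open>1\<close> left out, which makes it
  finite whenever \<open>\<alpha> - 1\<close> is finitely supported.
\<close>
definition Psi :: "('x \<Rightarrow> real) \<Rightarrow> ('x \<Rightarrow> bool) \<Rightarrow> real" where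
  "Psi \<alpha> \<omega> = (\<Prod>x | \<omega> x \<and> \<alpha> x \<noteq> 1. \<alpha> x)"

end

theory Submission
  imports Defs
begin

text \<open>
  Let \<open>\<rho>\<close> be the function \<open>\<rho> X = Pf [K\<^sub>S(x, y)]\<^bsub>x, y \<in> X\<^esub>\<close> on finite sets of sites.

  Since \<open>\<Psi>\<^sub>\<alpha>(\<omega>) = \<Prod>\<^sub>x (1 + (\<alpha> x - 1) \<omega> x)\<close>, expanding the product gives
  \<open>\<integral> \<Psi>\<^sub>\<alpha> dM = \<Sum>\<^sub>X (\<Prod>\<^bsub>x \<in> X\<^esub> (\<alpha> x - 1)) M(X occupied)\<close>, and by homogeneity of the Pfaffian the
  Fredholm Pfaffian is the same sum with \<open>\<rho> X\<close> in place of \<open>M(X occupied)\<close>.  Hence a process with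
  correlations \<open>\<rho>\<close> has the required property.  Conversely, choosing \<open>\<alpha> = 2\<close> on a finite set \<open>F\<close> and
  \<open>1\<close> elsewhere yields \<open>\<Sum>\<^bsub>X \<subseteq> F\<^esub> M(X occupied)\<close>, so an induction over \<open>F\<close> recovers all correlations
  from the integrals, and the events \<open>X occupied\<close> form a generator of the Borel sets that is stable
  under intersection.  This is uniqueness.

  For existence, Kolmogorov's extension theorem reduces the claim to the nonnegativity of the numbers
  that inclusion-exclusion assigns to the events \<open>X occupied, Y empty\<close>
  (\<open>point_process_of_correlations\<close>).  Two operations on covariances give this nonnegativity.

  \<^item> Exchanging particles and holes at a site \<open>y\<close> turns one covariance into another one and turns the
    event that \<open>y\<close> is empty into the event that \<open>y\<close> is occupied (\<open>pf_particle_hole\<close>).  Therefore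
    only the case of no empty sites is left, that is, \<open>Pf \<ge> 0\<close> for all covariances.

  \<^item> Eliminating the \<open>2 \<times> 2\<close> block of a site \<open>x\<close> from the matrix gives
    \<open>Pf = c \<cdot> Pf'\<close>, where \<open>c\<close> is a diagonal entry of \<open>S\<close>, hence nonnegative, and \<open>Pf'\<close> is the Pfaffian
    of a Schur complement on the remaining sites (\<open>pf_schur\<close>).  The Schur complement is again the
    kernel of a covariance (\<open>covariance_kernel_schur\<close>): \<open>c\<close> is the probability that \<open>x\<close> is occupied,
    and the Schur complement describes the conditional process.  If \<open>c = 0\<close>, then positivity of \<open>S\<close>
    makes a whole row vanish.  Induction over the sites finishes the argument.
\<close>

section \<open>Pfaffians of matrices\<close>

lemma permutes_less: "p permutes {..<n} \<Longrightarrow> i < n \<Longrightarrow> p i < (n::nat)"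
  using permutes_in_image[of p "{..<n}" i] by simp

lemma pfaffian_cong:
  assumes "\<And>i j. i < 2 * n \<Longrightarrow> j < 2 * n \<Longrightarrow> i \<noteq> j \<Longrightarrow> A i j = B i j"
  shows "pfaffian n A = pfaffian n B"
proof -
  have "(\<Prod>i<n. A (p (2 * i)) (p (2 * i + 1))) = (\<Prod>i<n. B (p (2 * i)) (p (2 * i + 1)))"
    if p: "p permutes {..<2 * n}" for p
  proof (rule prod.cong[OF refl])
    fix i assume "i \<in> {..<n}"
    then have "p (2 * i) \<in> {..<2 * n}" "p (2 * i + 1) \<in> {..<2 * n}" "p (2 * i) \<noteq> p (2 * i + 1)"
      using p by (auto intro!: permutes_less[OF p] simp: inj_eq[OF permutes_inj[OF p]])
    then show "A (p (2 * i)) (p (2 * i + 1)) = B (p (2 * i)) (p (2 * i + 1))"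
      using assms by auto
  qed
  then show ?thesis unfolding pfaffian_def by (auto intro!: sum.cong)
qed

lemma pfaffian_0 [simp]: "pfaffian 0 A = 1"
  by (simp add: pfaffian_def sign_id)

lemma sum_permutes_compose_right:
  fixes F :: "(nat \<Rightarrow> nat) \<Rightarrow> 'b::comm_monoid_add"
  assumes "\<sigma> permutes S"
  shows "(\<Sum>p | p permutes S. F (p \<circ> \<sigma>)) = (\<Sum>p | p permutes S. F p)"
  using sum.reindex_bij_betw[of "\<lambda>p. p \<circ> \<sigma>" "{p. p permutes S}" "{p. p permutes S}" F]
    bij_betw_byWitness[of "{p. p permutes S}" "\<lambda>p. p \<circ> inv \<sigma>" "\<lambda>p. p \<circ> \<sigma>" "{p. p permutes S}"]
    permutes_inv_o[OF assms] permutes_compose[OF assms] permutes_compose[OF permutes_inv[OF assms]]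
  by (auto simp: o_assoc[symmetric] image_subset_iff)

lemma sum_permutes_compose_left:
  fixes F :: "(nat \<Rightarrow> nat) \<Rightarrow> 'b::comm_monoid_add"
  assumes "\<sigma> permutes S"
  shows "(\<Sum>p | p permutes S. F (\<sigma> \<circ> p)) = (\<Sum>p | p permutes S. F p)"
  using sum.reindex_bij_betw[of "\<lambda>p. \<sigma> \<circ> p" "{p. p permutes S}" "{p. p permutes S}" F]
    bij_betw_byWitness[of "{p. p permutes S}" "\<lambda>p. inv \<sigma> \<circ> p" "\<lambda>p. \<sigma> \<circ> p" "{p. p permutes S}"]
    permutes_inv_o[OF assms] permutes_compose[OF _ assms] permutes_compose[OF _ permutes_inv[OF assms]]
  by (auto simp: o_assoc image_subset_iff)

lemma sign_compose_permutes:
  fixes p q :: "nat \<Rightarrow> nat"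
  assumes "p permutes {..<n}" "q permutes {..<n}"
  shows "sign (p \<circ> q) = sign p * sign q"
  using assms by (intro sign_compose) (auto intro: permutes_imp_permutation[of "{..<n}"])

text \<open>
  With \<open>\<sigma>\<close> a transposition this is the alternating property.  It comes from substituting \<open>\<sigma> \<circ> p\<close> for
  the summation variable \<open>p\<close>.
\<close>

lemma pfaffian_reindex:
  assumes \<sigma>: "\<sigma> permutes {..<2 * n}"
  shows "pfaffian n (\<lambda>i j. A (\<sigma> i) (\<sigma> j)) = of_int (sign \<sigma>) * pfaffian n A"
proof -
  have "(\<Sum>p | p permutes {..<2 * n}. of_int (sign p) * (\<Prod>i<n. A (\<sigma> (p (2 * i))) (\<sigma> (p (2 * i + 1)))))
     = (\<Sum>p | p permutes {..<2 * n}. of_int (sign \<sigma>) * (of_int (sign (\<sigma> \<circ> p)) *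
          (\<Prod>i<n. A ((\<sigma> \<circ> p) (2 * i)) ((\<sigma> \<circ> p) (2 * i + 1)))))"
  proof (intro sum.cong refl)
    fix p assume "p \<in> {p. p permutes {..<2 * n}}"
    then have "sign p = sign \<sigma> * sign (\<sigma> \<circ> p)"
      using \<sigma> by (simp add: sign_compose_permutes mult.assoc[symmetric])
    then show "of_int (sign p) * (\<Prod>i<n. A (\<sigma> (p (2 * i))) (\<sigma> (p (2 * i + 1)))) =
      of_int (sign \<sigma>) * (of_int (sign (\<sigma> \<circ> p)) *
          (\<Prod>i<n. A ((\<sigma> \<circ> p) (2 * i)) ((\<sigma> \<circ> p) (2 * i + 1))))"
      by simp
  qed
  also have "\<dots> = of_int (sign \<sigma>) * (\<Sum>p | p permutes {..<2 * n}. of_int (sign p) *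
          (\<Prod>i<n. A (p (2 * i)) (p (2 * i + 1))))"
    unfolding sum_distrib_left[symmetric]
    by (subst sum_permutes_compose_left[OF \<sigma>,
          of "\<lambda>p. of_int (sign p) * (\<Prod>i<n. A (p (2 * i)) (p (2 * i + 1)))"]) simp
  finally show ?thesis unfolding pfaffian_def by simp
qed

text \<open>
  A matrix whose rows and columns are pulled back along a map that identifies \<open>j\<close> and \<open>k\<close> is invariant
  under the transposition of \<open>j\<close> and \<open>k\<close>, while its Pfaffian changes sign.
\<close>

lemma pfaffian_equal_rows:
  assumes "j < 2 * n" "k < 2 * n" "j \<noteq> k" "\<phi> j = \<phi> k"
  shows "pfaffian n (\<lambda>a b. A (\<phi> a) (\<phi> b)) = 0"
proof -
  have "\<phi> (Transposition.transpose j k a) = \<phi> a" for a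
    using assms(4) by (cases "a = j"; cases "a = k") auto
  then have "pfaffian n (\<lambda>a b. A (\<phi> a) (\<phi> b)) = - pfaffian n (\<lambda>a b. A (\<phi> a) (\<phi> b))"
    using pfaffian_reindex[of "Transposition.transpose j k" n "\<lambda>a b. A (\<phi> a) (\<phi> b)"] assms
    by (simp add: permutes_swap_id sign_swap_id)
  then show ?thesis by simp
qed

lemma pfaffian_zero_row:
  assumes m: "m < 2 * n" and "\<And>j. j < 2 * n \<Longrightarrow> A m j = 0" "\<And>j. j < 2 * n \<Longrightarrow> A j m = 0"
  shows "pfaffian n A = 0"
proof -
  have "(\<Prod>i<n. A (p (2 * i)) (p (2 * i + 1))) = 0" if p: "p permutes {..<2 * n}" for p
  proof -
    obtain l where l: "l < 2 * n" "p l = m"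
      using p m permutes_image[OF p] by (metis imageE lessThan_iff)
    have "A (p (2 * (l div 2))) (p (2 * (l div 2) + 1)) = 0"
    proof (cases "even l")
      case True
      then have "l + 1 < 2 * n" using l by presburger
      then have "p (l + 1) < 2 * n" using permutes_in_image[OF p, of "l + 1"] by simp
      then show ?thesis using True l assms by simp
    next
      case False
      then have "p (l - 1) < 2 * n" using l permutes_in_image[OF p, of "l - 1"] by simp
      moreover have "2 * (l div 2) = l - 1" "2 * (l div 2) + 1 = l" using False by presburger+
      ultimately show ?thesis using l assms by simp
    qed
    moreover have "l div 2 \<in> {..<n}" using l by auto
    ultimately show ?thesis by (metis finite_lessThan prod_zero_iff)
  qed
  then have "(\<Sum>p | p permutes {..<2 * n}. of_int (sign p) * (\<Prod>i<n. A (p (2 * i)) (p (2 * i + 1)))) = 0"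
    by (intro sum.neutral) (simp del: prod_zero_iff)
  then show ?thesis unfolding pfaffian_def by simp
qed

text \<open>
  Used for the products in the definition of the Pfaffian when the matrix is changed in one row and
  column, or at one pair of positions: a permutation places a given index in exactly one of the
  factors, so at most one of them is perturbed.
\<close>

lemma prod_add_exclusive:
  fixes a d :: "'i \<Rightarrow> 'b::comm_semiring_1"
  assumes "finite I" "\<And>i j. i \<in> I \<Longrightarrow> j \<in> I \<Longrightarrow> i \<noteq> j \<Longrightarrow> d i * d j = 0"
  shows "(\<Prod>i\<in>I. a i + d i) = (\<Prod>i\<in>I. a i) + (\<Sum>m\<in>I. d m * (\<Prod>i\<in>I - {m}. a i))"
  using assms
proof (induction I rule: finite_induct)
  case (insert x I)
  have 1: "(\<Sum>m\<in>I. d m * (\<Prod>i\<in>insert x I - {m}. a i)) = a x * (\<Sum>m\<in>I. d m * (\<Prod>i\<in>I - {m}. a i))"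
    unfolding sum_distrib_left
  proof (rule sum.cong[OF refl])
    fix m assume "m \<in> I"
    then have "insert x I - {m} = insert x (I - {m})" using insert by auto
    then show "d m * (\<Prod>i\<in>insert x I - {m}. a i) = a x * (d m * (\<Prod>i\<in>I - {m}. a i))"
      using insert by (simp add: mult_ac)
  qed
  have 2: "d x * (\<Sum>m\<in>I. d m * (\<Prod>i\<in>I - {m}. a i)) = 0"
    unfolding sum_distrib_left
    using insert.prems insert.hyps by (intro sum.neutral) (metis insertCI mult.assoc mult_zero_left)
  have 3: "insert x I - {x} = I" using insert by auto
  show ?case
    using insert 1 2 3 by (simp add: distrib_left distrib_right add_ac)
qed simp

text \<open>
  An elementary row operation, carried out simultaneously on rows and columns.  The Pfaffian is linear
  in the \<open>j\<close>-th row and column together, and the term of first order is the Pfaffian of a matrix in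
  which \<open>j\<close> and \<open>k\<close> carry the same data.
\<close>

lemma pfaffian_add_row:
  assumes jk: "j < 2 * n" "k < 2 * n" "j \<noteq> k"
    and B: "\<And>a b. a < 2 * n \<Longrightarrow> b < 2 * n \<Longrightarrow> a \<noteq> b \<Longrightarrow>
      B a b = A a b + c * (if a = j then A k b else if b = j then A a k else 0)"
  shows "pfaffian n B = pfaffian n A"
proof -
  define \<phi> where "\<phi> = (\<lambda>a. if a = j then k else a)"
  define C where "C a b = (if a = j \<or> b = j then A (\<phi> a) (\<phi> b) else 0)" for a b
  have split: "(\<Prod>i<n. B (p (2 * i)) (p (2 * i + 1))) =
      (\<Prod>i<n. A (p (2 * i)) (p (2 * i + 1))) + c * (\<Prod>i<n. A (\<phi> (p (2 * i))) (\<phi> (p (2 * i + 1))))"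
    if p: "p permutes {..<2 * n}" for p
  proof -
    note inj = inj_eq[OF permutes_inj[OF p]]
    have "(\<Prod>i<n. B (p (2 * i)) (p (2 * i + 1))) =
        (\<Prod>i<n. A (p (2 * i)) (p (2 * i + 1)) + c * C (p (2 * i)) (p (2 * i + 1)))"
    proof (rule prod.cong[OF refl])
      fix i assume "i \<in> {..<n}"
      then have "p (2 * i) \<in> {..<2 * n}" "p (2 * i + 1) \<in> {..<2 * n}" "p (2 * i) \<noteq> p (2 * i + 1)"
        by (auto intro!: permutes_less[OF p] simp: inj)
      then show "B (p (2 * i)) (p (2 * i + 1)) =
         A (p (2 * i)) (p (2 * i + 1)) + c * C (p (2 * i)) (p (2 * i + 1))"
        using B[of "p (2 * i)" "p (2 * i + 1)"] by (auto simp: C_def \<phi>_def)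
    qed
    also have "\<dots> = (\<Prod>i<n. A (p (2 * i)) (p (2 * i + 1))) + (\<Sum>m<n. c * C (p (2 * m)) (p (2 * m + 1)) *
        (\<Prod>i\<in>{..<n} - {m}. A (p (2 * i)) (p (2 * i + 1))))"
    proof (rule prod_add_exclusive)
      fix i l assume "i \<in> {..<n}" "l \<in> {..<n}" "i \<noteq> l"
      have "2 * i \<noteq> 2 * l + 1" "2 * i + 1 \<noteq> 2 * l" by presburger+
      with \<open>i \<noteq> l\<close> have "p (2 * i) \<noteq> p (2 * l)" "p (2 * i) \<noteq> p (2 * l + 1)"
        "p (2 * i + 1) \<noteq> p (2 * l)" "p (2 * i + 1) \<noteq> p (2 * l + 1)"
        unfolding inj by auto
      then show "c * C (p (2 * i)) (p (2 * i + 1)) * (c * C (p (2 * l)) (p (2 * l + 1))) = 0"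
        unfolding C_def by auto
    qed simp
    also have "(\<Sum>m<n. c * C (p (2 * m)) (p (2 * m + 1)) *
        (\<Prod>i\<in>{..<n} - {m}. A (p (2 * i)) (p (2 * i + 1)))) =
        c * (\<Prod>i<n. A (\<phi> (p (2 * i))) (\<phi> (p (2 * i + 1))))"
    proof -
      obtain l where l: "l < 2 * n" "p l = j"
        using p jk permutes_image[OF p] by (metis imageE lessThan_iff)
      define m0 where "m0 = l div 2"
      have m0: "m0 < n" using l by (auto simp: m0_def)
      have lm0: "l = 2 * m0 \<or> l = 2 * m0 + 1" unfolding m0_def by presburger
      have ne: "p (2 * m) \<noteq> j" "p (2 * m + 1) \<noteq> j" if "m \<noteq> m0" for m
        using that lm0 l(2)[symmetric] unfolding l(2)[symmetric] inj by presburger+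
      have j0: "p (2 * m0) = j \<or> p (2 * m0 + 1) = j" using lm0 l by auto
      have "(\<Sum>m<n. c * C (p (2 * m)) (p (2 * m + 1)) *
        (\<Prod>i\<in>{..<n} - {m}. A (p (2 * i)) (p (2 * i + 1)))) =
        (\<Sum>m\<in>{m0}. c * C (p (2 * m)) (p (2 * m + 1)) *
        (\<Prod>i\<in>{..<n} - {m}. A (p (2 * i)) (p (2 * i + 1))))"
        by (rule sum.mono_neutral_right) (use m0 ne in \<open>auto simp: C_def\<close>)
      also have "(\<Prod>i\<in>{..<n} - {m0}. A (p (2 * i)) (p (2 * i + 1))) =
         (\<Prod>i\<in>{..<n} - {m0}. A (\<phi> (p (2 * i))) (\<phi> (p (2 * i + 1))))"
        by (rule prod.cong) (use ne in \<open>auto simp: \<phi>_def\<close>)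
      then have "(\<Sum>m\<in>{m0}. c * C (p (2 * m)) (p (2 * m + 1)) *
        (\<Prod>i\<in>{..<n} - {m}. A (p (2 * i)) (p (2 * i + 1)))) =
        c * (A (\<phi> (p (2 * m0))) (\<phi> (p (2 * m0 + 1))) *
        (\<Prod>i\<in>{..<n} - {m0}. A (\<phi> (p (2 * i))) (\<phi> (p (2 * i + 1)))))"
        using j0 by (auto simp: C_def)
      also have "\<dots> = c * (\<Prod>i<n. A (\<phi> (p (2 * i))) (\<phi> (p (2 * i + 1))))"
        using m0 by (subst prod.remove[of "{..<n}" m0]) auto
      finally show ?thesis .
    qed
    finally show ?thesis .
  qed
  have "pfaffian n B = pfaffian n A + c * pfaffian n (\<lambda>a b. A (\<phi> a) (\<phi> b))"
  proof -
    have "(\<Sum>p | p permutes {..<2 * n}. of_int (sign p) * (\<Prod>i<n. B (p (2 * i)) (p (2 * i + 1)))) =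
      (\<Sum>p | p permutes {..<2 * n}. of_int (sign p) * (\<Prod>i<n. A (p (2 * i)) (p (2 * i + 1))) +
        c * (of_int (sign p) * (\<Prod>i<n. A (\<phi> (p (2 * i))) (\<phi> (p (2 * i + 1))))))"
      by (rule sum.cong) (simp_all only: split mem_Collect_eq distrib_left mult.left_commute)
    then show ?thesis
      unfolding pfaffian_def by (simp add: sum.distrib add_divide_distrib sum_distrib_left)
  qed
  also have "pfaffian n (\<lambda>a b. A (\<phi> a) (\<phi> b)) = 0"
    by (rule pfaffian_equal_rows[of j n k]) (use jk in \<open>auto simp: \<phi>_def\<close>)
  finally show ?thesis by simp
qed

text \<open>
  The exchange of two \<open>2 \<times> 2\<close> blocks; being a product of two transpositions, it is an even permutation.
\<close>

definition block_swap :: "nat \<Rightarrow> nat \<Rightarrow> nat \<Rightarrow> nat" where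
  "block_swap a b = Transposition.transpose (2 * a) (2 * b) \<circ>
     Transposition.transpose (2 * a + 1) (2 * b + 1)"

lemma block_swap_apply:
  "block_swap a b (2 * i) = 2 * Transposition.transpose a b i"
  "block_swap a b (2 * i + 1) = 2 * Transposition.transpose a b i + 1"
proof -
  have [simp]: "Suc (2 * k) \<noteq> 2 * l" "2 * l \<noteq> Suc (2 * k)" for k l :: nat by presburger+
  show "block_swap a b (2 * i) = 2 * Transposition.transpose a b i"
    "block_swap a b (2 * i + 1) = 2 * Transposition.transpose a b i + 1"
    by (auto simp: block_swap_def Transposition.transpose_def)
qed

lemma block_swap_permutes:
  assumes "a < n" "b < n"
  shows "block_swap a b permutes {..<2 * n}"
  unfolding block_swap_def using assms by (intro permutes_compose permutes_swap_id) auto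

lemma sign_block_swap: "sign (block_swap a b) = 1"
  unfolding block_swap_def by (subst sign_compose) (simp_all add: permutation_swap_id sign_swap_id)

text \<open>
  The symplectic unit \<open>J\<close> in the first \<open>2 \<times> 2\<close> block.
\<close>

definition unit_pair :: "nat \<Rightarrow> nat \<Rightarrow> complex" where
  "unit_pair i j = of_bool (i = 0 \<and> j = 1) - of_bool (i = 1 \<and> j = 0)"

text \<open>
  The weight \<open>unit_pair (p 0) (p 1)\<close> selects the permutations that preserve \<open>{0, 1}\<close>.  Those that
  exchange the two points contribute as much as those that fix them, and the latter are permutations
  of the remaining indices.
\<close>

lemma sum_permutes_fixing_pair:
  "(\<Sum>p | p permutes {..<2 * Suc n}. of_int (sign p) * (unit_pair (p 0) (p 1) *
       (\<Prod>i\<in>{..<Suc n} - {0}. A (p (2 * i)) (p (2 * i + 1))))) =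
   2 * (\<Sum>q | q permutes {..<2 * n}. of_int (sign q) *
       (\<Prod>i<n. A (q (2 * i) + 2) (q (2 * i + 1) + 2)))"
proof -
  define P where "P = {p. p permutes {..<2 * Suc n}}"
  define F where "F p = (\<Prod>i\<in>{..<Suc n} - {0}. A (p (2 * i)) (p (2 * i + 1)))" for p :: "nat \<Rightarrow> nat"
  define \<tau> :: "nat \<Rightarrow> nat" where "\<tau> = Transposition.transpose 0 1"
  have fin: "finite P" unfolding P_def by (rule finite_permutations) simp
  have \<tau>: "\<tau> permutes {..<2 * Suc n}" unfolding \<tau>_def by (rule permutes_swap_id) auto
  have F\<tau>: "F (p \<circ> \<tau>) = F p" for p
    unfolding F_def \<tau>_def by (rule prod.cong) (auto simp: Transposition.transpose_def)
  have s\<tau>: "sign (p \<circ> \<tau>) = - sign p" if "p \<in> P" for p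
    using that \<tau> unfolding P_def
    by (subst sign_compose_permutes[of _ "2 * Suc n"]) (auto simp: \<tau>_def sign_swap_id)
  have "(\<Sum>p\<in>P. of_int (sign p) * (of_bool (p 0 = 1 \<and> p 1 = 0) * F p)) =
     (\<Sum>p\<in>P. of_int (sign (p \<circ> \<tau>)) * (of_bool ((p \<circ> \<tau>) 0 = 1 \<and> (p \<circ> \<tau>) 1 = 0) * F (p \<circ> \<tau>)))"
    unfolding P_def
    by (rule sum_permutes_compose_right[OF \<tau>,
       where F="\<lambda>p. of_int (sign p) * (of_bool (p 0 = 1 \<and> p 1 = 0) * F p)", symmetric])
  also have "\<dots> = - (\<Sum>p\<in>P. of_int (sign p) * (of_bool (p 0 = 0 \<and> p 1 = 1) * F p))"
    unfolding sum_negf[symmetric]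
    by (rule sum.cong[OF refl]) (auto simp: s\<tau> F\<tau>, auto simp: \<tau>_def)
  finally have flip: "(\<Sum>p\<in>P. of_int (sign p) * (of_bool (p 0 = 1 \<and> p 1 = 0) * F p)) =
    - (\<Sum>p\<in>P. of_int (sign p) * (of_bool (p 0 = 0 \<and> p 1 = 1) * F p))" .
  have "(\<Sum>p\<in>P. of_int (sign p) * (unit_pair (p 0) (p 1) * F p)) =
     (\<Sum>p\<in>P. of_int (sign p) * (of_bool (p 0 = 0 \<and> p 1 = 1) * F p)) -
     (\<Sum>p\<in>P. of_int (sign p) * (of_bool (p 0 = 1 \<and> p 1 = 0) * F p))"
    unfolding unit_pair_def by (simp add: sum_subtractf[symmetric] algebra_simps)
  also have "\<dots> = 2 * (\<Sum>p\<in>P. of_int (sign p) * (of_bool (p 0 = 0 \<and> p 1 = 1) * F p))"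
    unfolding flip by simp
  also have "(\<Sum>p\<in>P. of_int (sign p) * (of_bool (p 0 = 0 \<and> p 1 = 1) * F p)) =
     (\<Sum>p | p permutes {2..<2 * Suc n}. of_int (sign p) * F p)"
  proof (rule sum.mono_neutral_cong_right[OF fin])
    show "{p. p permutes {2..<2 * Suc n}} \<subseteq> P"
      unfolding P_def by (auto intro: permutes_subset)
    show "\<forall>p\<in>P - {p. p permutes {2..<2 * Suc n}}.
       of_int (sign p) * (of_bool (p 0 = 0 \<and> p 1 = 1) * F p) = 0"
    proof
      fix p assume p: "p \<in> P - {p. p permutes {2..<2 * Suc n}}"
      have "\<not> (p 0 = 0 \<and> p 1 = 1)"
      proof
        assume h: "p 0 = 0 \<and> p 1 = 1"
        have "p permutes {2..<2 * Suc n}"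
        proof (rule permutes_superset[where S="{..<2 * Suc n}"])
          show "p permutes {..<2 * Suc n}" using p by (simp add: P_def)
          fix x assume "x \<in> {..<2 * Suc n} - {2..<2 * Suc n}"
          then have "x = 0 \<or> x = 1" by auto
          then show "p x = x" using h by auto
        qed
        then show False using p by simp
      qed
      then show "of_int (sign p) * (of_bool (p 0 = 0 \<and> p 1 = 1) * F p) = 0" by simp
    qed
    fix p assume "p \<in> {p. p permutes {2..<2 * Suc n}}"
    then have "p 0 = 0" "p 1 = 1" by (auto intro!: permutes_not_in)
    then show "of_int (sign p) * (of_bool (p 0 = 0 \<and> p 1 = 1) * F p) = of_int (sign p) * F p" by simp
  qed
  also have "\<dots> = (\<Sum>q | q permutes {..<2 * n}. of_int (sign q) *
       (\<Prod>i<n. A (q (2 * i) + 2) (q (2 * i + 1) + 2)))"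
  proof -
    define up where "up = map_permutation {..<2 * n} (\<lambda>k. k + 2 :: nat)"
    define down where "down = map_permutation {2..<2 * Suc n} (\<lambda>k. k - 2 :: nat)"
    have bij: "bij_betw (\<lambda>k. k + 2 :: nat) {..<2 * n} {2..<2 * Suc n}"
      by (rule bij_betwI[where g="\<lambda>k. k - 2"]) auto
    have bij': "bij_betw (\<lambda>k. k - 2 :: nat) {2..<2 * Suc n} {..<2 * n}"
      by (rule bij_betwI[where g="\<lambda>k. k + 2"]) auto
    show ?thesis
    proof (rule sum.reindex_bij_witness[where i=up and j=down])
      fix p assume p: "p \<in> {p. p permutes {2..<2 * Suc n}}"
      show "up (down p) = p" unfolding up_def down_def
        by (rule map_permutation_compose_inv[OF bij']) (use p in auto)
      show d: "down p \<in> {q. q permutes {..<2 * n}}" unfolding down_def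
        using map_permutation_permutes[OF bij'] p by auto
      have sg: "sign (down p) = sign p" unfolding down_def
        by (rule sign_map_permutation) (use p bij' in \<open>auto simp: bij_betw_def\<close>)
      have ap: "down p k + 2 = p (k + 2)" if "k < 2 * n" for k
      proof -
        have "k + 2 \<in> {2..<2 * Suc n}" using that by auto
        then have "down p (k + 2 - 2) = p (k + 2) - 2" unfolding down_def
          by (intro map_permutation_apply) (use bij' in \<open>auto simp: bij_betw_def\<close>)
        moreover have "p (k + 2) \<in> {2..<2 * Suc n}"
          using p that by (subst permutes_in_image) auto
        then have "2 \<le> p (k + 2)" by simp
        ultimately show ?thesis by (metis add_diff_cancel_right' le_add_diff_inverse2)
      qed
      have "(\<Prod>i<n. A (down p (2 * i) + 2) (down p (2 * i + 1) + 2)) = (\<Prod>i<n. A (p (2 * Suc i)) (p (2 * Suc i + 1)))"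
        by (rule prod.cong) (auto simp: ap[unfolded add_2_eq_Suc'])
      also have "\<dots> = F p"
        unfolding F_def
        by (rule prod.reindex_bij_witness[where i="\<lambda>i. i - 1" and j=Suc]) auto
      finally show "of_int (sign (down p)) * (\<Prod>i<n. A (down p (2 * i) + 2) (down p (2 * i + 1) + 2))
         = of_int (sign p) * F p" by (simp add: sg)
    next
      fix q assume q: "q \<in> {q. q permutes {..<2 * n}}"
      show "down (up q) = q" unfolding up_def down_def
        by (rule map_permutation_compose_inv[OF bij]) (use q in auto)
      show "up q \<in> {p. p permutes {2..<2 * Suc n}}" unfolding up_def
        using map_permutation_permutes[OF bij] q by auto
    qed
  qed
  finally show ?thesis unfolding P_def F_def .
qed

text \<open>
  The expansion of \<open>Pf (A + t J)\<close> in \<open>t\<close> with \<open>J\<close> supported in the first block: the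
  \<open>t\<close>-linear term collects the permutations that send some block onto \<open>{0, 1}\<close>.  There are \<open>n + 1\<close>
  choices of this block and two orientations, which accounts exactly for the change of the
  normalisation from \<open>2\<^sup>n\<^sup>+\<^sup>1 (n + 1)!\<close> to \<open>2\<^sup>n n!\<close>.
\<close>

lemma pfaffian_add_unit_pair:
  assumes B: "\<And>i j. i < 2 * Suc n \<Longrightarrow> j < 2 * Suc n \<Longrightarrow> i \<noteq> j \<Longrightarrow> B i j = A i j + t * unit_pair i j"
  shows "pfaffian (Suc n) B = pfaffian (Suc n) A + t * pfaffian n (\<lambda>i j. A (i + 2) (j + 2))"
proof -
  let ?N = "Suc n"
  define P where "P = {p. p permutes {..<2 * ?N}}"
  define G where "G m p = unit_pair (p (2 * m)) (p (2 * m + 1)) *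
     (\<Prod>i\<in>{..<?N} - {m}. A (p (2 * i)) (p (2 * i + 1)))" for m and p :: "nat \<Rightarrow> nat"
  have split: "(\<Prod>i<?N. B (p (2 * i)) (p (2 * i + 1))) =
      (\<Prod>i<?N. A (p (2 * i)) (p (2 * i + 1))) + (\<Sum>m<?N. t * G m p)" if "p \<in> P" for p
  proof -
    have p: "p permutes {..<2 * ?N}" using that by (simp add: P_def)
    note inj = inj_eq[OF permutes_inj[OF p]]
    have "(\<Prod>i<?N. B (p (2 * i)) (p (2 * i + 1))) =
        (\<Prod>i<?N. A (p (2 * i)) (p (2 * i + 1)) + t * unit_pair (p (2 * i)) (p (2 * i + 1)))"
    proof (rule prod.cong[OF refl])
      fix i assume "i \<in> {..<?N}"
      then have "2 * i < 2 * ?N" "2 * i + 1 < 2 * ?N" by auto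
      then have "p (2 * i) < 2 * ?N" "p (2 * i + 1) < 2 * ?N" "p (2 * i) \<noteq> p (2 * i + 1)"
        by (blast intro: permutes_less[OF p], blast intro: permutes_less[OF p], simp add: inj)
      then show "B (p (2 * i)) (p (2 * i + 1)) =
         A (p (2 * i)) (p (2 * i + 1)) + t * unit_pair (p (2 * i)) (p (2 * i + 1))"
        using B by blast
    qed
    also have "\<dots> = (\<Prod>i<?N. A (p (2 * i)) (p (2 * i + 1))) +
       (\<Sum>m<?N. t * unit_pair (p (2 * m)) (p (2 * m + 1)) *
        (\<Prod>i\<in>{..<?N} - {m}. A (p (2 * i)) (p (2 * i + 1))))"
    proof (rule prod_add_exclusive)
      fix i l :: nat assume "i \<in> {..<?N}" "l \<in> {..<?N}" "i \<noteq> l"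
      have "2 * i \<noteq> 2 * l + 1" "2 * i + 1 \<noteq> 2 * l" by presburger+
      with \<open>i \<noteq> l\<close> have "p (2 * i) \<noteq> p (2 * l)" "p (2 * i) \<noteq> p (2 * l + 1)"
        "p (2 * i + 1) \<noteq> p (2 * l)" "p (2 * i + 1) \<noteq> p (2 * l + 1)"
        unfolding inj by auto
      then show "t * unit_pair (p (2 * i)) (p (2 * i + 1)) * (t * unit_pair (p (2 * l)) (p (2 * l + 1))) = 0"
        unfolding unit_pair_def by auto
    qed simp
    finally show ?thesis by (simp add: G_def mult.assoc)
  qed
  have G0: "(\<Sum>p\<in>P. of_int (sign p) * G m p) = (\<Sum>p\<in>P. of_int (sign p) * G 0 p)" if m: "m < ?N" for m
  proof -
    let ?\<sigma> = "block_swap 0 m" and ?\<tau> = "Transposition.transpose 0 m"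
    have \<sigma>: "?\<sigma> permutes {..<2 * ?N}" by (rule block_swap_permutes) (use m in auto)
    have "(\<Sum>p\<in>P. of_int (sign p) * G 0 p) = (\<Sum>p\<in>P. of_int (sign (p \<circ> ?\<sigma>)) * G 0 (p \<circ> ?\<sigma>))"
      unfolding P_def by (rule sum_permutes_compose_right[OF \<sigma>, where F="\<lambda>p. of_int (sign p) * G 0 p", symmetric])
    also have "\<dots> = (\<Sum>p\<in>P. of_int (sign p) * G m p)"
    proof (rule sum.cong[OF refl])
      fix p assume "p \<in> P"
      then have s: "sign (p \<circ> ?\<sigma>) = sign p"
        using \<sigma> by (subst sign_compose_permutes[of _ "2 * ?N"]) (auto simp: P_def sign_block_swap)
      have "(\<Prod>i\<in>{..<?N} - {0}. A (p (2 * ?\<tau> i)) (p (2 * ?\<tau> i + 1))) =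
        (\<Prod>i\<in>{..<?N} - {m}. A (p (2 * i)) (p (2 * i + 1)))"
        by (rule prod.reindex_bij_witness[where i="?\<tau>" and j="?\<tau>"])
          (use m in \<open>auto simp: Transposition.transpose_def\<close>)
      moreover have "?\<sigma> 0 = 2 * m" "?\<sigma> 1 = 2 * m + 1"
        using block_swap_apply[of 0 m 0] by simp_all
      ultimately have "G 0 (p \<circ> ?\<sigma>) = G m p"
        unfolding G_def o_def block_swap_apply by simp
      then show "of_int (sign (p \<circ> ?\<sigma>)) * G 0 (p \<circ> ?\<sigma>) = of_int (sign p) * G m p" by (simp add: s)
    qed
    finally show ?thesis by simp
  qed
  have "(\<Sum>p\<in>P. of_int (sign p) * (\<Prod>i<?N. B (p (2 * i)) (p (2 * i + 1)))) =
     (\<Sum>p\<in>P. of_int (sign p) * (\<Prod>i<?N. A (p (2 * i)) (p (2 * i + 1))) +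
        (\<Sum>m<?N. t * (of_int (sign p) * G m p)))"
    by (rule sum.cong[OF refl])
      (simp only: split distrib_left sum_distrib_left mult.left_commute)
  also have "\<dots> = (\<Sum>p\<in>P. of_int (sign p) * (\<Prod>i<?N. A (p (2 * i)) (p (2 * i + 1)))) +
     t * (\<Sum>m<?N. \<Sum>p\<in>P. of_int (sign p) * G m p)"
    unfolding sum.distrib sum_distrib_left by (subst (2) sum.swap) (rule refl)
  also have "(\<Sum>m<?N. \<Sum>p\<in>P. of_int (sign p) * G m p) = of_nat ?N * (\<Sum>p\<in>P. of_int (sign p) * G 0 p)"
  proof -
    have "(\<Sum>m<?N. \<Sum>p\<in>P. of_int (sign p) * G m p) = (\<Sum>m<?N. \<Sum>p\<in>P. of_int (sign p) * G 0 p)"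
      by (rule sum.cong[OF refl]) (rule G0, simp)
    then show ?thesis by (simp only: sum_constant card_lessThan)
  qed
  also have "(\<Sum>p\<in>P. of_int (sign p) * G 0 p) =
     2 * (\<Sum>q | q permutes {..<2 * n}. of_int (sign q) *
       (\<Prod>i<n. A (q (2 * i) + 2) (q (2 * i + 1) + 2)))"
    using sum_permutes_fixing_pair[where n=n and A=A] unfolding P_def G_def by simp
  finally have E: "(\<Sum>p\<in>P. of_int (sign p) * (\<Prod>i<?N. B (p (2 * i)) (p (2 * i + 1)))) =
     (\<Sum>p\<in>P. of_int (sign p) * (\<Prod>i<?N. A (p (2 * i)) (p (2 * i + 1)))) +
     t * (of_nat ?N * (2 * (\<Sum>q | q permutes {..<2 * n}. of_int (sign q) *
       (\<Prod>i<n. A (q (2 * i) + 2) (q (2 * i + 1) + 2)))))" .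
  have cancel: "t * (of_nat ?N * (2 * s)) / (2 ^ ?N * fact ?N) = t * (s / (2 ^ n * fact n))" for s :: complex
  proof -
    have "(of_nat ?N :: complex) \<noteq> 0" by (rule of_nat_neq_0)
    then show ?thesis
      unfolding fact_Suc power_Suc by (simp add: field_simps del: of_nat_Suc)
  qed
  show ?thesis
    unfolding pfaffian_def E[unfolded P_def] add_divide_distrib cancel ..
qed

text \<open>
  Gaussian elimination with the pivot block \<open>{0, 1}\<close>.  Adding suitable multiples of the rows \<open>0\<close> and \<open>1\<close>
  to every other row makes the matrix block diagonal; the first block is then split off by
  \<open>pfaffian_add_unit_pair\<close>.
\<close>

lemma pfaffian_schur:
  assumes skew: "\<And>i j. i < 2 * Suc n \<Longrightarrow> j < 2 * Suc n \<Longrightarrow> a j i = - a i j"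
    and c: "a 0 1 \<noteq> 0"
  defines "a' \<equiv> \<lambda>i j. a i j + (a i 0 * a 1 j - a i 1 * a 0 j) / a 0 1"
  shows "pfaffian (Suc n) a = a 0 1 * pfaffian n (\<lambda>i j. a' (i + 2) (j + 2))"
proof -
  let ?N = "Suc n" and ?c = "a 0 1"
  \<comment> \<open>The matrix after the rows and columns \<open>2, \<dots>, m - 1\<close> have been cleared.  An entry is already that of the
  Schur complement as soon as one of its two indices has been treated, since a cleared row is
  orthogonal to the rows \<open>0\<close> and \<open>1\<close>.\<close>
  define D where "D m i j = (if (2 \<le> i \<and> i < m) \<or> (2 \<le> j \<and> j < m) then a' i j else a i j)" for m i j
  have diag: "a i i = 0" if "i < 2 * ?N" for i
    using skew[OF that that] by simp
  have a10: "a 1 0 = - ?c" by (rule skew) auto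
  have kill: "a' i 0 = 0" "a' i 1 = 0" "a' 0 i = 0" "a' 1 i = 0" for i
    using c diag[of 0] diag[of 1] a10 by (simp_all add: a'_def)
  note kill = kill kill[unfolded One_nat_def]
  have step: "pfaffian ?N (D (Suc m)) = pfaffian ?N (D m)" if m: "2 \<le> m" "m < 2 * ?N" for m
  proof -
    \<comment> \<open>The coefficients that make \<open>e\<^sub>m + \<alpha> e\<^sub>0 + \<beta> e\<^sub>1\<close> orthogonal to \<open>e\<^sub>0\<close> and \<open>e\<^sub>1\<close> with respect to the form \<open>a\<close>.\<close>
    define \<alpha> where "\<alpha> = - a m 1 / ?c"
    define \<beta> where "\<beta> = a m 0 / ?c"
    define E where "E i j = D m i j + \<alpha> * (if i = m then D m 0 j else if j = m then D m i 0 else 0)" for i j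
    have elim_row: "a' m j = a m j + \<alpha> * a 0 j + \<beta> * a 1 j" for j
      by (simp add: a'_def \<alpha>_def \<beta>_def diff_divide_distrib)
    have elim_col: "a' i m = a i m + \<alpha> * a i 0 + \<beta> * a i 1" if "i < 2 * ?N" for i
      using skew[of 1 m] skew[of 0 m] m
      by (simp add: a'_def \<alpha>_def \<beta>_def diff_divide_distrib mult.commute)
    have "pfaffian ?N (D (Suc m)) = pfaffian ?N E"
    proof (rule pfaffian_add_row[where j=m and k=1 and c=\<beta>])
      fix i j assume ij: "i < 2 * ?N" "j < 2 * ?N" "i \<noteq> j"
      show "D (Suc m) i j = E i j + \<beta> * (if i = m then E 1 j else if j = m then E i 1 else 0)"
      proof (cases "i = m")
        case True
        then show ?thesis
          using ij m by (auto simp: D_def E_def kill elim_row)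
      next
        case False
        show ?thesis
        proof (cases "j = m")
          case True
          then show ?thesis
            using ij m False by (auto simp: D_def E_def kill elim_col)
        next
          case False
          then show ?thesis using \<open>i \<noteq> m\<close> by (auto simp: D_def E_def less_Suc_eq)
        qed
      qed
    qed (use m in auto)
    also have "\<dots> = pfaffian ?N (D m)"
      by (rule pfaffian_add_row[where j=m and k=0 and c=\<alpha>]) (use m in \<open>auto simp: E_def\<close>)
    finally show ?thesis .
  qed
  have "pfaffian ?N (D m) = pfaffian ?N (D 2)" if "2 \<le> m" "m \<le> 2 * ?N" for m
    using that by (induction m rule: dec_induct) (auto simp: step)
  then have "pfaffian ?N (D (2 * ?N)) = pfaffian ?N (D 2)" by (rule) auto
  also have "D 2 = a" by (auto simp: D_def fun_eq_iff)
  finally have 1: "pfaffian ?N a = pfaffian ?N (D (2 * ?N))" by simp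
  define Z where "Z i j = (if i < 2 \<or> j < 2 then 0 else a' i j)" for i j
  have "pfaffian ?N (D (2 * ?N)) = pfaffian ?N Z + ?c * pfaffian n (\<lambda>i j. Z (i + 2) (j + 2))"
  proof (rule pfaffian_add_unit_pair)
    fix i j assume ij: "i < 2 * ?N" "j < 2 * ?N" "i \<noteq> j"
    consider "i \<ge> 2" "j \<ge> 2" | "i = 0" "j \<ge> 2" | "i = 1" "j \<ge> 2" | "i \<ge> 2" "j = 0" | "i \<ge> 2" "j = 1"
      | "i = 0" "j = 1" | "i = 1" "j = 0"
    proof -
      have "i = 0 \<or> i = 1 \<or> i \<ge> 2" "j = 0 \<or> j = 1 \<or> j \<ge> 2" by linarith+
      then show thesis using that ij(3) by blast
    qed
    then show "D (2 * ?N) i j = Z i j + ?c * unit_pair i j"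
      by cases (use ij a10 in \<open>auto simp: D_def Z_def unit_pair_def kill\<close>)
  qed
  also have "pfaffian ?N Z = 0"
    by (rule pfaffian_zero_row[of 0]) (auto simp: Z_def)
  finally show ?thesis unfolding 1 by (simp add: Z_def)
qed

section \<open>Pfaffians along a list of sites\<close>

text \<open>
  The scalar indices are pairs of a site and a component, where \<open>False\<close> stands for the first and \<open>True\<close>
  for the second component of the doubled space.  This makes the symmetries of the kernel visible as maps of the
  index set.
\<close>

definition site_index :: "'x list \<Rightarrow> nat \<Rightarrow> 'x \<times> bool" where
  "site_index xs i = (xs ! (i div 2), odd i)"

definition pf :: "('x \<times> bool \<Rightarrow> 'x \<times> bool \<Rightarrow> complex) \<Rightarrow> 'x list \<Rightarrow> complex" where
  "pf A xs = pfaffian (length xs) (\<lambda>i j. A (site_index xs i) (site_index xs j))"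

definition scalar_kernel :: "'x kernel \<Rightarrow> 'x \<times> bool \<Rightarrow> 'x \<times> bool \<Rightarrow> complex" where
  "scalar_kernel K i j = K (fst i) (fst j) $ (if snd i then 2 else 1) $ (if snd j then 2 else 1)"

lemma pf_list_eq_pf: "pf_list K xs = pf (scalar_kernel K) xs"
  unfolding pf_list_def pf_def
  by (rule pfaffian_cong) (auto simp: block_matrix_def scalar_kernel_def site_index_def)

lemma site_index_in: "i < 2 * length xs \<Longrightarrow> site_index xs i \<in> set xs \<times> UNIV"
  by (auto simp: site_index_def)

lemma site_index_Cons [simp]:
  "site_index (x # xs) 0 = (x, False)" "site_index (x # xs) 1 = (x, True)"
  "site_index (x # xs) (Suc 0) = (x, True)"
  "site_index (x # xs) (i + 2) = site_index xs i"
  "site_index (x # xs) (Suc (Suc i)) = site_index xs i"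
  by (auto simp: site_index_def)

lemma site_index_Cons_eq:
  assumes "x \<notin> set xs" "i < 2 * length (x # xs)"
  shows "site_index (x # xs) i = (x, b) \<longleftrightarrow> i = (if b then 1 else 0)"
proof (cases "i < 2")
  case True
  then have "i = 0 \<or> i = 1" by auto
  then show ?thesis by auto
next
  case False
  define k where "k = i - 2"
  then have k: "i = k + 2" using False by simp
  then have "fst (site_index (x # xs) i) \<noteq> x"
    using assms site_index_in[of k xs] by (auto simp: mem_Times_iff)
  then show ?thesis using False by auto
qed

lemma pf_cong:
  assumes "\<And>i j. i \<in> set xs \<times> UNIV \<Longrightarrow> j \<in> set xs \<times> UNIV \<Longrightarrow> A i j = B i j"
  shows "pf A xs = pf B xs"
  unfolding pf_def by (rule pfaffian_cong) (use assms site_index_in in blast)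

lemma pf_Nil [simp]: "pf A [] = 1"
  by (simp add: pf_def)

text \<open>
  A permutation of the sites is a product of exchanges of blocks, and these are even.
\<close>

lemma pf_permute_list:
  assumes "p permutes {..<length xs}"
  shows "pf A (permute_list p xs) = pf A xs"
proof -
  have "\<forall>xs. length xs = n \<longrightarrow> pf A (permute_list p xs) = pf A xs" if "p permutes {..<n}" for n
    using that finite_lessThan
  proof (induction rule: permutes_induct)
    case (swap a b p)
    show ?case
    proof (intro allI impI)
      fix xs :: "'a list" assume n: "length xs = n"
      let ?t = "Transposition.transpose a b"
      have t: "?t permutes {..<length xs}" using swap n by (auto intro: permutes_swap_id)
      have "permute_list (?t \<circ> p) xs = permute_list p (permute_list ?t xs)"
        by (rule permute_list_compose) (use swap n in auto)
      then have "pf A (permute_list (?t \<circ> p) xs) = pf A (permute_list ?t xs)"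
        using swap n by simp
      also have "\<dots> = pf A xs"
      proof -
        have "site_index (permute_list ?t xs) i = site_index xs (block_swap a b i)" if "i < 2 * n" for i
        proof (cases "even i")
          case True
          then obtain k where "i = 2 * k" by blast
          then show ?thesis
            using that n permute_list_nth[OF t, of k] block_swap_apply(1)[of a b k]
            by (simp add: site_index_def)
        next
          case False
          then obtain k where "i = 2 * k + 1" by (metis oddE)
          then show ?thesis
            using that n permute_list_nth[OF t, of k] block_swap_apply(2)[of a b k]
            by (simp add: site_index_def)
        qed
        then have "pf A (permute_list ?t xs) =
           pfaffian n (\<lambda>i j. A (site_index xs (block_swap a b i)) (site_index xs (block_swap a b j)))"
          unfolding pf_def length_permute_list n by (intro pfaffian_cong) simp
        also have "\<dots> = pf A xs"
          using swap n by (subst pfaffian_reindex) (auto simp: block_swap_permutes sign_block_swap pf_def)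
        finally show ?thesis .
      qed
      finally show "pf A (permute_list (?t \<circ> p) xs) = pf A xs" .
    qed
  qed simp
  then show ?thesis using assms by blast
qed

lemma pf_mset_cong: "mset xs = mset ys \<Longrightarrow> pf A xs = pf A ys"
  by (metis mset_eq_permutation pf_permute_list)

lemma pf_not_distinct:
  assumes "\<not> distinct xs"
  shows "pf A xs = 0"
proof -
  obtain i j where ij: "i < length xs" "j < length xs" "i \<noteq> j" "xs ! i = xs ! j"
    using assms by (auto simp: distinct_conv_nth)
  show ?thesis unfolding pf_def
    by (rule pfaffian_equal_rows[of "2 * i" _ "2 * j"]) (use ij in \<open>auto simp: site_index_def\<close>)
qed

definition site_pair :: "'x \<Rightarrow> 'x \<times> bool \<Rightarrow> 'x \<times> bool \<Rightarrow> complex" where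
  "site_pair x i j = of_bool (i = (x, False) \<and> j = (x, True)) - of_bool (i = (x, True) \<and> j = (x, False))"

lemma pf_add_site_pair:
  assumes "x \<notin> set xs"
  shows "pf (\<lambda>i j. A i j + t * site_pair x i j) (x # xs) = pf A (x # xs) + t * pf A xs"
proof -
  have "pf (\<lambda>i j. A i j + t * site_pair x i j) (x # xs) = pf A (x # xs) +
     t * pfaffian (length xs) (\<lambda>i j. A (site_index (x # xs) (i + 2)) (site_index (x # xs) (j + 2)))"
    unfolding pf_def list.size(4) add_Suc_right add_0_right
  proof (rule pfaffian_add_unit_pair)
    fix i j assume "i < 2 * Suc (length xs)" "j < 2 * Suc (length xs)"
    then have "site_index (x # xs) k = (x, b) \<longleftrightarrow> k = (if b then 1 else 0)" if "k \<in> {i, j}" for k b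
      using that assms by (intro site_index_Cons_eq) auto
    then have "site_pair x (site_index (x # xs) i) (site_index (x # xs) j) = unit_pair i j"
      unfolding site_pair_def unit_pair_def by simp
    then show "A (site_index (x # xs) i) (site_index (x # xs) j) +
      t * site_pair x (site_index (x # xs) i) (site_index (x # xs) j) =
      A (site_index (x # xs) i) (site_index (x # xs) j) + t * unit_pair i j"
      by simp
  qed
  then show ?thesis by (simp add: pf_def)
qed

definition swap_at :: "'x \<Rightarrow> 'x \<times> bool \<Rightarrow> 'x \<times> bool" where
  "swap_at x i = (fst i, if fst i = x then \<not> snd i else snd i)"

lemma pf_swap_at:
  assumes "x \<notin> set xs"
  shows "pf (\<lambda>i j. A (swap_at x i) (swap_at x j)) (x # xs) = - pf A (x # xs)"
proof -
  let ?t = "Transposition.transpose 0 (1::nat)"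
  have "swap_at x (site_index (x # xs) i) = site_index (x # xs) (?t i)" if i: "i < 2 * length (x # xs)" for i
  proof (cases "i < 2")
    case True
    then have "i = 0 \<or> i = 1" by auto
    then show ?thesis by (auto simp: swap_at_def)
  next
    case False
    define k where "k = i - 2"
    then have k: "i = k + 2" using False by simp
    then have "fst (site_index (x # xs) i) \<noteq> x"
      using assms i site_index_in[of k xs] by (auto simp: mem_Times_iff)
    moreover have "?t i = i" using False by (auto simp: Transposition.transpose_def)
    ultimately show ?thesis by (simp add: swap_at_def)
  qed
  then have "pf (\<lambda>i j. A (swap_at x i) (swap_at x j)) (x # xs) =
    pfaffian (length (x # xs)) (\<lambda>i j. A (site_index (x # xs) (?t i)) (site_index (x # xs) (?t j)))"
    unfolding pf_def by (intro pfaffian_cong) simp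
  also have "\<dots> = - pf A (x # xs)"
    by (subst pfaffian_reindex[where \<sigma>="?t"]) (auto intro!: permutes_swap_id simp: sign_swap_id pf_def)
  finally show ?thesis .
qed

text \<open>
  The Schur complement of the block of \<open>x\<close>.  For an antisymmetric kernel this block is
  \<open>[[0, c], [-c, 0]]\<close> with \<open>c = A (x, False) (x, True)\<close>, and its inverse has been written out.
\<close>

definition schur :: "'x \<Rightarrow> ('x \<times> bool \<Rightarrow> 'x \<times> bool \<Rightarrow> complex) \<Rightarrow> 'x \<times> bool \<Rightarrow> 'x \<times> bool \<Rightarrow> complex" where
  "schur x A i j = A i j + (A i (x, False) * A (x, True) j - A i (x, True) * A (x, False) j)
      / A (x, False) (x, True)"

lemma pf_schur:
  assumes "\<And>i j. i \<in> set (x # xs) \<times> UNIV \<Longrightarrow> j \<in> set (x # xs) \<times> UNIV \<Longrightarrow> A j i = - A i j"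
    and "A (x, False) (x, True) \<noteq> 0"
  shows "pf A (x # xs) = A (x, False) (x, True) * pf (schur x A) xs"
proof -
  have "pf A (x # xs) = A (site_index (x # xs) 0) (site_index (x # xs) 1) *
    pfaffian (length xs) (\<lambda>i j. schur x A (site_index xs i) (site_index xs j))"
    unfolding pf_def list.size(4) add_Suc_right add_0_right
  proof (subst pfaffian_schur)
    fix i j assume "i < 2 * Suc (length xs)" "j < 2 * Suc (length xs)"
    then show "A (site_index (x # xs) j) (site_index (x # xs) i) = - A (site_index (x # xs) i) (site_index (x # xs) j)"
      by (intro assms(1) site_index_in) auto
  qed (use assms(2) in \<open>simp_all add: schur_def\<close>)
  then show ?thesis by (simp add: pf_def)
qed

lemma pf_zero_row:
  assumes "i \<in> set xs \<times> UNIV" "\<And>j. j \<in> set xs \<times> UNIV \<Longrightarrow> A i j = 0 \<and> A j i = 0"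
  shows "pf A xs = 0"
proof -
  obtain k where k: "k < length xs" "xs ! k = fst i" using assms(1) by (auto simp: in_set_conv_nth)
  define m where "m = (if snd i then 2 * k + 1 else 2 * k)"
  have "m < 2 * length xs" "site_index xs m = i"
    using k by (auto simp: m_def site_index_def prod_eq_iff)
  then show ?thesis unfolding pf_def using assms(2) site_index_in[of _ xs]
    by (intro pfaffian_zero_row[of m]) auto
qed

lemma prod_lessThan_double:
  fixes f :: "nat \<Rightarrow> 'b::comm_monoid_mult"
  shows "(\<Prod>k<2 * n. f k) = (\<Prod>i<n. f (2 * i) * f (2 * i + 1))"
  by (induction n) (auto simp: mult_ac)

text \<open>
  Every index occurs exactly once in each product of the Pfaffian, and every site owns two indices.
\<close>

lemma pf_scale:
  fixes s :: "'x \<Rightarrow> complex"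
  assumes "distinct xs"
  shows "pf (\<lambda>i j. s (fst i) * s (fst j) * A i j) xs = (\<Prod>x\<in>set xs. (s x)\<^sup>2) * pf A xs"
proof -
  let ?n = "length xs" and ?v = "site_index xs"
  have "(\<Prod>i<?n. s (fst (?v (p (2 * i)))) * s (fst (?v (p (2 * i + 1)))) * A (?v (p (2 * i))) (?v (p (2 * i + 1))))
     = (\<Prod>x\<in>set xs. (s x)\<^sup>2) * (\<Prod>i<?n. A (?v (p (2 * i))) (?v (p (2 * i + 1))))"
    if p: "p permutes {..<2 * ?n}" for p
  proof -
    have "(\<Prod>i<?n. s (fst (?v (p (2 * i)))) * s (fst (?v (p (2 * i + 1))))) = (\<Prod>k<2 * ?n. s (fst (?v (p k))))"
      by (simp add: prod_lessThan_double)
    also have "\<dots> = (\<Prod>k<2 * ?n. s (fst (?v k)))"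
      using prod.permute[OF p, of "\<lambda>k. s (fst (?v k))"] by (simp add: o_def)
    also have "\<dots> = (\<Prod>i<?n. (s (xs ! i))\<^sup>2)"
      by (simp add: prod_lessThan_double site_index_def power2_eq_square)
    also have "\<dots> = (\<Prod>x\<in>set xs. (s x)\<^sup>2)"
      using prod.reindex_bij_betw[OF bij_betw_nth[OF assms refl refl], of "\<lambda>x. (s x)\<^sup>2"]
      by (simp add: lessThan_atLeast0)
    finally show ?thesis by (simp add: prod.distrib)
  qed
  then show ?thesis unfolding pf_def pfaffian_def
    by (simp add: sum_distrib_left mult.left_commute)
qed

text \<open>
  The choice of the enumeration is the one made by \<open>pf_set\<close>.
\<close>

definition pf_on :: "('x \<times> bool \<Rightarrow> 'x \<times> bool \<Rightarrow> complex) \<Rightarrow> 'x set \<Rightarrow> complex" where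
  "pf_on A X = pf A (SOME xs. distinct xs \<and> set xs = X)"

lemma pf_on_set:
  assumes "distinct xs"
  shows "pf_on A (set xs) = pf A xs"
proof -
  have "distinct (SOME ys. distinct ys \<and> set ys = set xs) \<and> set (SOME ys. distinct ys \<and> set ys = set xs) = set xs"
    by (rule someI[of _ xs]) (use assms in simp)
  then have "mset (SOME ys. distinct ys \<and> set ys = set xs) = mset xs"
    using assms set_eq_iff_mset_eq_distinct by blast
  then show ?thesis unfolding pf_on_def by (rule pf_mset_cong)
qed

lemma pf_set_eq_pf_on: "pf_set K X = pf_on (scalar_kernel K) X"
  by (simp add: pf_set_def pf_on_def pf_list_eq_pf)

section \<open>Positive semidefinite matrices\<close>

definition pos_semidef :: "'i set \<Rightarrow> ('i \<Rightarrow> 'i \<Rightarrow> complex) \<Rightarrow> bool" where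
  "pos_semidef I T \<longleftrightarrow> (\<forall>i\<in>I. \<forall>j\<in>I. T j i = cnj (T i j)) \<and>
     (\<forall>u. 0 \<le> Re (\<Sum>i\<in>I. \<Sum>j\<in>I. cnj (u i) * T i j * u j))"

lemma pos_semidefD:
  assumes "pos_semidef I T"
  shows pos_semidef_hermitian: "i \<in> I \<Longrightarrow> j \<in> I \<Longrightarrow> T j i = cnj (T i j)"
    and pos_semidef_nonneg: "0 \<le> Re (\<Sum>i\<in>I. \<Sum>j\<in>I. cnj (u i) * T i j * u j)"
  using assms unfolding pos_semidef_def by blast+

lemma pos_semidef_cong: "(\<And>i j. i \<in> I \<Longrightarrow> j \<in> I \<Longrightarrow> T i j = T' i j) \<Longrightarrow> pos_semidef I T \<longleftrightarrow> pos_semidef I T'"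
  unfolding pos_semidef_def by (auto cong: sum.cong)

lemma pos_semidef_subset:
  assumes "pos_semidef I T" "finite I" "J \<subseteq> I"
  shows "pos_semidef J T"
  unfolding pos_semidef_def
proof (intro conjI ballI allI)
  fix u :: "_ \<Rightarrow> complex"
  define v where "v i = (if i \<in> J then u i else 0)" for i
  have "(\<Sum>i\<in>I. \<Sum>j\<in>I. cnj (v i) * T i j * v j) = (\<Sum>i\<in>J. \<Sum>j\<in>I. cnj (v i) * T i j * v j)"
    by (rule sum.mono_neutral_right) (use assms in \<open>auto simp: v_def\<close>)
  also have "\<dots> = (\<Sum>i\<in>J. \<Sum>j\<in>J. cnj (v i) * T i j * v j)"
    by (intro sum.cong refl sum.mono_neutral_right) (use assms in \<open>auto simp: v_def\<close>)
  also have "\<dots> = (\<Sum>i\<in>J. \<Sum>j\<in>J. cnj (u i) * T i j * u j)"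
    by (intro sum.cong refl) (auto simp: v_def)
  finally show "0 \<le> Re (\<Sum>i\<in>J. \<Sum>j\<in>J. cnj (u i) * T i j * u j)"
    using pos_semidef_nonneg[OF assms(1), of v] by simp
next
  fix i j assume "i \<in> J" "j \<in> J"
  then show "T j i = cnj (T i j)"
    using pos_semidef_hermitian[OF assms(1), of i j] assms(3) by blast
qed

lemma pos_semidef_diagonal:
  assumes "pos_semidef I T" "finite I" "q \<in> I"
  shows "T q q \<in> \<real>\<^sub>\<ge>\<^sub>0"
proof -
  have "pos_semidef {q} T" using pos_semidef_subset[OF assms(1,2), of "{q}"] assms(3) by simp
  from pos_semidef_nonneg[OF this, of "\<lambda>_. 1"] pos_semidef_hermitian[OF this, of q q]
  show ?thesis by (auto simp: complex_nonneg_Reals_iff complex_eq_iff)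
qed

text \<open>
  Otherwise a suitable multiple of \<open>e\<^sub>q\<close> added to \<open>e\<^sub>j\<close> would make the quadratic form negative.
\<close>

lemma pos_semidef_zero_diagonal:
  assumes "pos_semidef I T" "finite I" "q \<in> I" "j \<in> I" "T q q = 0"
  shows "T q j = 0"
proof (rule ccontr)
  assume nz: "T q j \<noteq> 0"
  then have qj: "q \<noteq> j" using assms(5) by auto
  have pos_semidef: "pos_semidef {q, j} T" using pos_semidef_subset[OF assms(1,2), of "{q, j}"] assms(3,4) by simp
  have h: "T j q = cnj (T q j)" using pos_semidef_hermitian[OF pos_semidef, of q j] by simp
  \<comment> \<open>With this multiple the quadratic form takes the value \<open>T j j - (T j j + 1) = -1\<close>.\<close>
  define s where "s = (Re (T j j) + 1) / (2 * (cmod (T q j))\<^sup>2)"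
  have s: "2 * s * (cmod (T q j))\<^sup>2 = Re (T j j) + 1" using nz by (simp add: s_def)
  have norm: "(complex_of_real (cmod (T q j)))\<^sup>2 = T q j * cnj (T q j)"
    by (metis complex_norm_square of_real_power)
  define u where "u i = (if i = q then - of_real s * T q j else 1)" for i
  have "(\<Sum>a\<in>{q, j}. \<Sum>b\<in>{q, j}. cnj (u a) * T a b * u b) =
     T j j - of_real (2 * s * (cmod (T q j))\<^sup>2)"
    using qj norm by (simp add: u_def assms(5) h algebra_simps)
  then have "Re (\<Sum>a\<in>{q, j}. \<Sum>b\<in>{q, j}. cnj (u a) * T a b * u b) = -1"
    unfolding s by simp
  with pos_semidef_nonneg[OF pos_semidef, of u] show False by linarith
qed

text \<open>
  The form of the Schur complement at \<open>u\<close> is the form of \<open>T\<close> at the vector \<open>v\<close> that minimises it among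
  all extensions of \<open>u\<close> to the index \<open>q\<close>.
\<close>

lemma pos_semidef_schur:
  assumes pos_semidef: "pos_semidef (insert q I) T" and I: "finite I" "q \<notin> I" and c: "T q q \<noteq> 0"
  shows "pos_semidef I (\<lambda>i j. T i j - T i q * T q j / T q q)"
  unfolding pos_semidef_def
proof (intro conjI ballI allI)
  let ?c = "T q q"
  have cc: "cnj ?c = ?c" using pos_semidef_hermitian[OF pos_semidef, of q q] by simp
  { fix i j assume "i \<in> I" "j \<in> I"
    then show "T j i - T j q * T q i / ?c = cnj (T i j - T i q * T q j / ?c)"
      using pos_semidef_hermitian[OF pos_semidef, of i j] pos_semidef_hermitian[OF pos_semidef, of q j] pos_semidef_hermitian[OF pos_semidef, of i q] cc
      by simp }
  fix u
  define L where "L = (\<Sum>j\<in>I. T q j * u j)"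
  define Q where "Q = (\<Sum>i\<in>I. \<Sum>j\<in>I. cnj (u i) * T i j * u j)"
  have L': "(\<Sum>i\<in>I. cnj (u i) * T i q) = cnj L"
    unfolding L_def cnj_sum
  proof (rule sum.cong[OF refl])
    fix i assume "i \<in> I"
    then show "cnj (u i) * T i q = cnj (T q i * u i)"
      using pos_semidef_hermitian[OF pos_semidef, of q i] by simp
  qed
  define v where "v = u(q := - L / ?c)"
  have vI: "v i = u i" if "i \<in> I" for i using that I by (auto simp: v_def)
  have "(\<Sum>i\<in>insert q I. \<Sum>j\<in>insert q I. cnj (v i) * T i j * v j) =
      cnj (v q) * ?c * v q + cnj (v q) * L + cnj L * v q + Q"
  proof -
    have "(\<Sum>i\<in>I. cnj (u i) * T i q * v q) = cnj L * v q"
      unfolding L'[symmetric] sum_distrib_right ..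
    moreover have "(\<Sum>j\<in>I. cnj (v q) * T q j * u j) = cnj (v q) * L"
      unfolding L_def sum_distrib_left mult.assoc ..
    ultimately show ?thesis
      using I by (simp add: vI sum.distrib Q_def cong: sum.cong)
  qed
  also have "\<dots> = Q - cnj L * L / ?c"
    using c by (simp add: v_def cc field_simps)
  also have "\<dots> = (\<Sum>i\<in>I. \<Sum>j\<in>I. cnj (u i) * (T i j - T i q * T q j / ?c) * u j)"
  proof -
    have "cnj L * L / ?c = (\<Sum>i\<in>I. \<Sum>j\<in>I. cnj (u i) * (T i q * T q j / ?c) * u j)"
      unfolding L'[symmetric] unfolding L_def sum_product sum_divide_distrib
      by (intro sum.cong refl) simp
    then show ?thesis by (simp add: Q_def sum_subtractf[symmetric] algebra_simps)
  qed
  finally show "0 \<le> Re (\<Sum>i\<in>I. \<Sum>j\<in>I. cnj (u i) * (T i j - T i q * T q j / ?c) * u j)"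
    using pos_semidef_nonneg[OF pos_semidef, of v] by simp
qed

lemma pos_semidef_add_rank_one:
  assumes "pos_semidef I T" "r \<ge> 0"
  shows "pos_semidef I (\<lambda>i j. T i j + of_real r * (w i * cnj (w j)))"
  unfolding pos_semidef_def
proof (intro conjI ballI allI)
  fix u
  define L where "L = (\<Sum>i\<in>I. cnj (u i) * w i)"
  have "(\<Sum>i\<in>I. \<Sum>j\<in>I. cnj (u i) * (T i j + of_real r * (w i * cnj (w j))) * u j) =
    (\<Sum>i\<in>I. \<Sum>j\<in>I. cnj (u i) * T i j * u j) + of_real r * (L * cnj L)"
  proof -
    have "L * cnj L = (\<Sum>i\<in>I. \<Sum>j\<in>I. cnj (u i) * w i * (u j * cnj (w j)))"
      unfolding L_def cnj_sum sum_product by simp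
    then show ?thesis
      by (simp add: sum_distrib_left sum.distrib[symmetric] algebra_simps)
  qed
  moreover have "0 \<le> Re (of_real r * (L * cnj L))"
    using assms(2) by (simp add: complex_mult_cnj)
  ultimately show "0 \<le> Re (\<Sum>i\<in>I. \<Sum>j\<in>I. cnj (u i) * (T i j + of_real r * (w i * cnj (w j))) * u j)"
    using pos_semidef_nonneg[OF assms(1), of u] by simp
next
  fix i j assume "i \<in> I" "j \<in> I"
  then show "T j i + of_real r * (w j * cnj (w i)) = cnj (T i j + of_real r * (w i * cnj (w j)))"
    using pos_semidef_hermitian[OF assms(1), of i j] by simp
qed

lemma pos_semidef_reindex:
  assumes "pos_semidef I T" "bij_betw f I I" "finite I"
  shows "pos_semidef I (\<lambda>i j. T (f i) (f j))"
  unfolding pos_semidef_def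
proof (intro conjI ballI allI)
  have fI: "f i \<in> I" if "i \<in> I" for i using assms(2) that by (auto simp: bij_betw_def)
  { fix i j assume "i \<in> I" "j \<in> I"
    then show "T (f j) (f i) = cnj (T (f i) (f j))" using pos_semidef_hermitian[OF assms(1)] fI by blast }
  fix u :: "_ \<Rightarrow> complex"
  define v where "v i = u (inv_into I f i)" for i
  have v: "v (f i) = u i" if "i \<in> I" for i
    using that assms(2) by (simp add: v_def bij_betw_def)
  have "(\<Sum>i\<in>I. \<Sum>j\<in>I. cnj (v i) * T i j * v j) = (\<Sum>i\<in>I. \<Sum>j\<in>I. cnj (v (f i)) * T (f i) (f j) * v (f j))"
    by (subst sum.reindex_bij_betw[OF assms(2), symmetric]) 
      (intro sum.cong refl sum.reindex_bij_betw[OF assms(2), symmetric])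
  also have "\<dots> = (\<Sum>i\<in>I. \<Sum>j\<in>I. cnj (u i) * T (f i) (f j) * u j)"
    by (intro sum.cong refl) (simp add: v)
  finally show "0 \<le> Re (\<Sum>i\<in>I. \<Sum>j\<in>I. cnj (u i) * T (f i) (f j) * u j)"
    using pos_semidef_nonneg[OF assms(1), of v] by simp
qed

section \<open>Nonnegative Pfaffians of covariance kernels\<close>

definition flip :: "'x \<times> bool \<Rightarrow> 'x \<times> bool" where
  "flip i = (fst i, \<not> snd i)"

text \<open>
  The kernel of a covariance \<open>S\<close> arises from the matrix of \<open>S\<close> by subtracting the projection onto the
  first component and then exchanging the two components in the row index.  This definition undoes
  both steps.
\<close>

definition covariance_matrix :: "('x \<times> bool \<Rightarrow> 'x \<times> bool \<Rightarrow> complex) \<Rightarrow> 'x \<times> bool \<Rightarrow> 'x \<times> bool \<Rightarrow> complex" where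
  "covariance_matrix A i j = A (flip i) j + of_bool (i = j \<and> \<not> snd i)"

text \<open>
  The restriction to the sites in \<open>\<Lambda>\<close> of a kernel that comes from a covariance.  Given that the matrix
  \<open>S\<close> is Hermitian, antisymmetry of the kernel expresses the relation \<open>\<Gamma> S \<Gamma> = 1 - S\<close>, which turns
  \<open>0 \<le> S\<close> into \<open>S \<le> 1\<close>; so positivity expresses both bounds on \<open>S\<close>.
\<close>

definition covariance_kernel :: "'x set \<Rightarrow> ('x \<times> bool \<Rightarrow> 'x \<times> bool \<Rightarrow> complex) \<Rightarrow> bool" where
  "covariance_kernel \<Lambda> A \<longleftrightarrow>
     (\<forall>i\<in>\<Lambda> \<times> UNIV. \<forall>j\<in>\<Lambda> \<times> UNIV. A j i = - A i j) \<and> pos_semidef (\<Lambda> \<times> UNIV) (covariance_matrix A)"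

lemma covariance_kernelD:
  assumes "covariance_kernel \<Lambda> A"
  shows covariance_kernel_skew:
      "i \<in> \<Lambda> \<times> UNIV \<Longrightarrow> j \<in> \<Lambda> \<times> UNIV \<Longrightarrow> A j i = - A i j"
    and covariance_kernel_psd: "pos_semidef (\<Lambda> \<times> UNIV) (covariance_matrix A)"
  using assms unfolding covariance_kernel_def by blast+

lemma covariance_kernelI:
  assumes "\<And>i j. i \<in> \<Lambda> \<times> UNIV \<Longrightarrow> j \<in> \<Lambda> \<times> UNIV \<Longrightarrow> A j i = - A i j"
    and "pos_semidef (\<Lambda> \<times> UNIV) (covariance_matrix A)"
  shows "covariance_kernel \<Lambda> A"
  using assms unfolding covariance_kernel_def by blast

lemma covariance_kernel_subset:
  "covariance_kernel \<Lambda> A \<Longrightarrow> finite \<Lambda> \<Longrightarrow> \<Lambda>' \<subseteq> \<Lambda> \<Longrightarrow> covariance_kernel \<Lambda>' A"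
  by (rule covariance_kernelI)
    (auto intro: covariance_kernel_skew pos_semidef_subset[OF covariance_kernel_psd])

text \<open>
  On the level of covariance matrices the passage to the Schur complement subtracts the rank one term of
  the Schur complement of the diagonal entry at \<open>(x, True)\<close>, which keeps the matrix positive, and adds a
  positive rank one term built from the column of \<open>(x, False)\<close>.
\<close>

lemma covariance_kernel_schur:
  assumes cov: "covariance_kernel (insert x \<Lambda>) A" and \<Lambda>: "finite \<Lambda>" "x \<notin> \<Lambda>"
    and c: "A (x, False) (x, True) \<noteq> 0"
  shows "covariance_kernel \<Lambda> (schur x A)"
proof -
  define T where "T = covariance_matrix A"
  define p where "p = (x, False)"
  define q where "q = (x, True)"
  let ?I = "\<Lambda> \<times> (UNIV :: bool set)"
  have skew: "A j i = - A i j" if "i \<in> insert x \<Lambda> \<times> UNIV" "j \<in> insert x \<Lambda> \<times> UNIV" for i j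
    by (rule covariance_kernel_skew[OF cov that])
  have pos_semidef: "pos_semidef (insert x \<Lambda> \<times> UNIV) T" using covariance_kernel_psd[OF cov] by (simp only: T_def)
  have pos_semidefq: "pos_semidef (insert q ?I) T"
    by (rule pos_semidef_subset[OF pos_semidef]) (use \<Lambda> in \<open>auto simp: q_def\<close>)
  have Tqq: "T q q = A p q" by (simp add: T_def covariance_matrix_def q_def p_def flip_def)
  have "A p q \<in> \<real>\<^sub>\<ge>\<^sub>0" using pos_semidef_diagonal[OF pos_semidefq, of q] \<Lambda> Tqq by simp
  then obtain r where r: "A p q = of_real r" "r \<ge> 0" by (auto elim: nonneg_Reals_cases)
  have "pos_semidef ?I (\<lambda>i j. (T i j - T i q * T q j / T q q) + of_real (1 / r) * (T i p * cnj (T j p)))"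
    by (rule pos_semidef_add_rank_one) (use pos_semidef_schur[OF pos_semidefq] \<Lambda> Tqq c r in \<open>auto simp: q_def p_def\<close>)
  moreover have "(T i j - T i q * T q j / T q q) + of_real (1 / r) * (T i p * cnj (T j p)) =
     covariance_matrix (schur x A) i j" if "i \<in> ?I" "j \<in> ?I" for i j
  proof -
    have ne: "i \<noteq> p" "i \<noteq> q" "p \<noteq> j" "q \<noteq> j" using that \<Lambda> by (auto simp: p_def q_def)
    have 1: "A (flip i) p = T i p" "A (flip i) q = T i q" "A q j = T p j" "A p j = T q j"
      using ne by (simp_all add: T_def covariance_matrix_def) (simp_all add: flip_def p_def q_def)
    have 2: "cnj (T j p) = T p j" using pos_semidef_hermitian[OF pos_semidef, of j p] that by (auto simp: p_def)
    show ?thesis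
      unfolding covariance_matrix_def schur_def p_def[symmetric] q_def[symmetric] 1 2 Tqq r
      using 1 by (simp add: T_def covariance_matrix_def diff_divide_distrib)
  qed
  ultimately have "pos_semidef ?I (covariance_matrix (schur x A))" by (simp cong: pos_semidef_cong)
  moreover have "schur x A j i = - schur x A i j" if "i \<in> ?I" "j \<in> ?I" for i j
  proof -
    have "i \<in> insert x \<Lambda> \<times> UNIV" "j \<in> insert x \<Lambda> \<times> UNIV" "p \<in> insert x \<Lambda> \<times> UNIV" "q \<in> insert x \<Lambda> \<times> UNIV"
      using that by (auto simp: p_def q_def)
    then have "A j i = - A i j" "A i p = - A p i" "A i q = - A q i" "A j p = - A p j" "A j q = - A q j"
      by (blast intro: skew)+
    then show ?thesis
      unfolding schur_def p_def[symmetric] q_def[symmetric]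
      by (simp add: diff_divide_distrib mult.commute)
  qed
  ultimately show ?thesis by (intro covariance_kernelI)
qed

text \<open>
  The scalar \<open>c = A (x, False) (x, True)\<close> that is split off at each site is the diagonal entry of the covariance
  matrix at \<open>(x, True)\<close>.
\<close>

lemma pf_nonneg:
  assumes "covariance_kernel (set xs) A" "distinct xs"
  shows "pf A xs \<in> \<real>\<^sub>\<ge>\<^sub>0"
  using assms
proof (induction xs arbitrary: A)
  case (Cons x xs)
  let ?I = "set (x # xs) \<times> (UNIV :: bool set)" and ?c = "A (x, False) (x, True)"
  have skew: "A j i = - A i j" if "i \<in> ?I" "j \<in> ?I" for i j
    by (rule covariance_kernel_skew[OF Cons.prems(1) that])
  have pos_semidef: "pos_semidef ?I (covariance_matrix A)" using covariance_kernel_psd[OF Cons.prems(1)] .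
  have c: "covariance_matrix A (x, True) (x, True) = ?c"
    by (simp add: covariance_matrix_def flip_def)
  then have c0: "?c \<in> \<real>\<^sub>\<ge>\<^sub>0" using pos_semidef_diagonal[OF pos_semidef, of "(x, True)"] by simp
  show ?case
  proof (cases "?c = 0")
    case True
    have "A (x, False) j = 0" if "j \<in> ?I" for j
    proof -
      have "covariance_matrix A (x, True) j = 0"
        by (rule pos_semidef_zero_diagonal[OF pos_semidef]) (use True c that in auto)
      then show ?thesis by (simp add: covariance_matrix_def flip_def)
    qed
    moreover from this have "A j (x, False) = 0" if "j \<in> ?I" for j
      using skew[of "(x, False)" j] that by auto
    ultimately have "pf A (x # xs) = 0" by (intro pf_zero_row[of "(x, False)"]) auto
    then show ?thesis by simp
  next
    case False
    have "pf A (x # xs) = ?c * pf (schur x A) xs"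
      using skew False by (intro pf_schur) blast+
    moreover have "pf (schur x A) xs \<in> \<real>\<^sub>\<ge>\<^sub>0"
      using Cons.prems False by (intro Cons.IH covariance_kernel_schur) auto
    ultimately show ?thesis using c0 by (simp add: nonneg_Reals_mult_I)
  qed
qed simp

text \<open>
  The covariance with the two components at \<open>y\<close> exchanged.  The kernel is obtained from the covariance
  by subtracting the projection onto the first component, and this projection is not invariant
  under the exchange; the difference produces the term \<open>site_pair y\<close>.
\<close>

definition particle_hole :: "'x \<Rightarrow> ('x \<times> bool \<Rightarrow> 'x \<times> bool \<Rightarrow> complex) \<Rightarrow> 'x \<times> bool \<Rightarrow> 'x \<times> bool \<Rightarrow> complex" where
  "particle_hole y A i j = A (swap_at y i) (swap_at y j) + site_pair y i j"

lemma covariance_kernel_particle_hole: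
  assumes cov: "covariance_kernel \<Lambda> A" and "finite \<Lambda>"
  shows "covariance_kernel \<Lambda> (particle_hole y A)"
proof -
  let ?I = "\<Lambda> \<times> (UNIV :: bool set)" and ?s = "swap_at y"
  have "bij_betw ?s ?I ?I"
    by (rule bij_betwI[where g="?s"]) (auto simp: swap_at_def)
  then have "pos_semidef ?I (\<lambda>i j. covariance_matrix A (?s i) (?s j))"
    using pos_semidef_reindex[OF covariance_kernel_psd[OF cov], of ?s] assms(2) by simp
  moreover have "covariance_matrix A (?s i) (?s j) = covariance_matrix (particle_hole y A) i j" for i j
  proof -
    obtain a b a' b' where "i = (a, b)" "j = (a', b')" by (cases i, cases j)
    then show ?thesis
      by (cases b; cases b'; cases "a = y"; cases "a' = y")
        (simp_all add: covariance_matrix_def particle_hole_def swap_at_def site_pair_def flip_def)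
  qed
  ultimately have "pos_semidef ?I (covariance_matrix (particle_hole y A))" by simp
  moreover have "particle_hole y A j i = - particle_hole y A i j" if "i \<in> ?I" "j \<in> ?I" for i j
  proof -
    have "?s i \<in> ?I" "?s j \<in> ?I" using that by (auto simp: swap_at_def)
    then have "A (?s j) (?s i) = - A (?s i) (?s j)" by (rule covariance_kernel_skew[OF cov])
    moreover have "site_pair y j i = - site_pair y i j" by (auto simp: site_pair_def)
    ultimately show ?thesis by (simp add: particle_hole_def)
  qed
  ultimately show ?thesis by (intro covariance_kernelI)
qed

text \<open>
  If Pfaffians are read as probabilities, the right-hand side is the probability that all sites of
  \<open>xs\<close> are occupied and \<open>y\<close> is empty.  The minus sign is the sign of the transposition of the two
  indices at \<open>y\<close>.
\<close>

lemma pf_particle_hole: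
  assumes "y \<notin> set xs"
  shows "pf (particle_hole y A) (y # xs) = pf A xs - pf A (y # xs)"
proof -
  have "pf (particle_hole y A) (y # xs) = pf (\<lambda>i j. A (swap_at y i) (swap_at y j)) (y # xs) +
     pf (\<lambda>i j. A (swap_at y i) (swap_at y j)) xs"
    using pf_add_site_pair[OF assms, of "\<lambda>i j. A (swap_at y i) (swap_at y j)" 1]
    by (simp add: particle_hole_def[abs_def])
  also have "pf (\<lambda>i j. A (swap_at y i) (swap_at y j)) xs = pf A xs"
    by (rule pf_cong) (use assms in \<open>auto simp: swap_at_def\<close>)
  finally show ?thesis using pf_swap_at[OF assms, of A] by simp
qed

section \<open>Inclusion-exclusion\<close>

text \<open>
  If \<open>\<rho> X\<close> is the probability that all points of \<open>X\<close> are occupied, then this is the probability that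
  moreover all points of \<open>Y\<close> are empty.
\<close>

definition incl_excl :: "('x set \<Rightarrow> 'b::comm_ring_1) \<Rightarrow> 'x set \<Rightarrow> 'x set \<Rightarrow> 'b" where
  "incl_excl \<rho> X Y = (\<Sum>Z\<in>Pow Y. (-1) ^ card Z * \<rho> (X \<union> Z))"

lemma sum_Pow_insert:
  assumes "finite Y" "y \<notin> Y"
  shows "(\<Sum>Z\<in>Pow (insert y Y). f Z) = (\<Sum>Z\<in>Pow Y. f Z) + (\<Sum>Z\<in>Pow Y. f (insert y Z))"
proof -
  have "inj_on (insert y) (Pow Y)"
  proof (rule inj_onI)
    fix Z Z' assume "Z \<in> Pow Y" "Z' \<in> Pow Y" "insert y Z = insert y Z'"
    moreover from this have "y \<notin> Z" "y \<notin> Z'" using assms(2) by auto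
    ultimately show "Z = Z'" by (simp add: insert_ident)
  qed
  then have "(\<Sum>Z\<in>insert y ` Pow Y. f Z) = (\<Sum>Z\<in>Pow Y. f (insert y Z))"
    by (simp add: sum.reindex)
  moreover have "Pow Y \<inter> insert y ` Pow Y = {}" using assms(2) by auto
  ultimately show ?thesis
    unfolding Pow_insert using assms(1) by (subst sum.union_disjoint) auto
qed

lemma incl_excl_empty [simp]: "incl_excl \<rho> X {} = \<rho> X"
  by (simp add: incl_excl_def)

lemma incl_excl_insert:
  assumes "finite Y" "y \<notin> Y"
  shows "incl_excl \<rho> X (insert y Y) = incl_excl \<rho> X Y - incl_excl \<rho> (insert y X) Y"
proof -
  have "(\<Sum>Z\<in>Pow Y. (-1) ^ card (insert y Z) * \<rho> (X \<union> insert y Z)) = - incl_excl \<rho> (insert y X) Y"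
    unfolding incl_excl_def sum_negf[symmetric]
  proof (rule sum.cong[OF refl])
    fix Z assume "Z \<in> Pow Y"
    then have "card (insert y Z) = Suc (card Z)"
      using assms by (subst card_insert_disjoint) (auto intro: finite_subset)
    then show "(-1) ^ card (insert y Z) * \<rho> (X \<union> insert y Z) = - ((-1) ^ card Z * \<rho> (insert y X \<union> Z))"
      by simp
  qed
  moreover have "incl_excl \<rho> X (insert y Y) =
      incl_excl \<rho> X Y + (\<Sum>Z\<in>Pow Y. (-1) ^ card (insert y Z) * \<rho> (X \<union> insert y Z))"
    unfolding incl_excl_def by (rule sum_Pow_insert[OF assms])
  ultimately show ?thesis by simp
qed

text \<open>
  The event \<open>X occupied, Y empty\<close> is split according to the configuration in \<open>W\<close>.
\<close>

lemma incl_excl_refine: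
  assumes "finite W" "finite Y" "W \<inter> Y = {}"
  shows "(\<Sum>Z\<in>Pow W. incl_excl \<rho> (X \<union> Z) (Y \<union> (W - Z))) = incl_excl \<rho> X Y"
  using assms
proof (induction W rule: finite_induct)
  case (insert w W)
  have "(\<Sum>Z\<in>Pow (insert w W). incl_excl \<rho> (X \<union> Z) (Y \<union> (insert w W - Z))) =
     (\<Sum>Z\<in>Pow W. incl_excl \<rho> (X \<union> Z) (Y \<union> (insert w W - Z)) +
        incl_excl \<rho> (X \<union> insert w Z) (Y \<union> (insert w W - insert w Z)))"
    using insert.hyps by (simp add: sum_Pow_insert sum.distrib)
  also have "\<dots> = (\<Sum>Z\<in>Pow W. incl_excl \<rho> (X \<union> Z) (Y \<union> (W - Z)))"
  proof (rule sum.cong[OF refl])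
    fix Z assume Z: "Z \<in> Pow W"
    have 1: "Y \<union> (insert w W - Z) = insert w (Y \<union> (W - Z))"
      "Y \<union> (insert w W - insert w Z) = Y \<union> (W - Z)" using Z insert.hyps by auto
    have "finite (Y \<union> (W - Z))" "w \<notin> Y \<union> (W - Z)" using insert.hyps insert.prems by auto
    from incl_excl_insert[OF this, of \<rho> "X \<union> Z"]
    show "incl_excl \<rho> (X \<union> Z) (Y \<union> (insert w W - Z)) +
        incl_excl \<rho> (X \<union> insert w Z) (Y \<union> (insert w W - insert w Z)) =
        incl_excl \<rho> (X \<union> Z) (Y \<union> (W - Z))"
      unfolding 1 by simp
  qed
  also have "\<dots> = incl_excl \<rho> X Y" using insert by auto
  finally show ?case .
qed simp

text \<open>
  Each empty site is moved to the occupied ones by a particle-hole exchange, at the price of a new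
  covariance kernel.
\<close>

lemma incl_excl_pf_nonneg:
  assumes "finite \<Lambda>" "covariance_kernel \<Lambda> A" "X \<subseteq> \<Lambda>" "Y \<subseteq> \<Lambda>" "X \<inter> Y = {}"
  shows "incl_excl (pf_on A) X Y \<in> \<real>\<^sub>\<ge>\<^sub>0"
proof -
  have "finite Y" using assms finite_subset by blast
  then show ?thesis using assms(2-)
  proof (induction Y arbitrary: A X rule: finite_induct)
    case empty
    obtain xs where xs: "distinct xs" "set xs = X"
      using finite_distinct_list[OF finite_subset[OF empty(2) assms(1)]] by blast
    have "covariance_kernel (set xs) A"
      using covariance_kernel_subset[OF empty(1) assms(1)] empty xs by simp
    then show ?case using pf_nonneg[of xs A] xs pf_on_set[of xs A] by simp
  next
    case (insert y Y)
    have fin: "finite X" "finite Y" using insert.prems assms(1) finite_subset by auto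
    have "pf_on (particle_hole y A) (insert y (X \<union> Z)) = pf_on A (X \<union> Z) - pf_on A (insert y (X \<union> Z))"
      if "Z \<in> Pow Y" for Z
    proof -
      have "finite (X \<union> Z)" using fin that finite_subset by auto
      then obtain zs where zs: "distinct zs" "set zs = X \<union> Z" using finite_distinct_list by blast
      moreover have y: "y \<notin> set zs" using insert zs that by auto
      ultimately show ?thesis
        using pf_particle_hole[OF y, of A] pf_on_set[of zs A] pf_on_set[of "y # zs" A]
          pf_on_set[of "y # zs" "particle_hole y A"] by simp
    qed
    then have "incl_excl (pf_on (particle_hole y A)) (insert y X) Y =
      incl_excl (pf_on A) X Y - incl_excl (pf_on A) (insert y X) Y"
      unfolding incl_excl_def sum_subtractf[symmetric]
      by (intro sum.cong refl) (simp add: right_diff_distrib)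
    also have "\<dots> = incl_excl (pf_on A) X (insert y Y)"
      by (rule incl_excl_insert[OF insert.hyps, symmetric])
    finally show ?case
      using insert.IH[of "particle_hole y A" "insert y X"] insert.prems insert.hyps
        covariance_kernel_particle_hole[OF insert.prems(1) assms(1)] by auto
  qed
qed

section \<open>Point processes with prescribed correlations\<close>

text \<open>
  This makes the Borel sets of the configuration space those of the countable product.
\<close>

instance bool :: second_countable_topology
proof
  have "open = generate_topology (UNIV :: bool set set)"
    by (rule ext) (simp add: discrete_topology_class.open_discrete generate_topology.Basis)
  then show "\<exists>B :: bool set set. countable B \<and> open = generate_topology B"
    by (intro exI[of _ UNIV]) auto
qed

definition all_occupied :: "'x set \<Rightarrow> ('x \<Rightarrow> bool) set" where
  "all_occupied X = {\<omega>. \<forall>x\<in>X. \<omega> x}"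

lemma sets_borel_config:
  "sets (borel :: ('x::countable \<Rightarrow> bool) measure) = sigma_sets UNIV {all_occupied X | X. finite X}"
  (is "_ = sigma_sets UNIV ?E")
proof -
  have "sets (borel :: ('x \<Rightarrow> bool) measure) = sets (\<Pi>\<^sub>M i\<in>(UNIV :: 'x set). (borel :: bool measure))"
    by (rule sets_PiM_equal_borel[symmetric])
  also have "\<dots> = sigma_sets UNIV {{f. f i \<in> A} | (i::'x) A. A \<in> sets (borel :: bool measure)}"
    unfolding sets_PiM_single by simp
  also have "\<dots> = sigma_sets UNIV ?E"
  proof (rule sigma_sets_eqI)
    interpret sigma_algebra "UNIV :: ('x \<Rightarrow> bool) set" "sigma_sets UNIV ?E"
      by (rule sigma_algebra_sigma_sets) auto
    fix B :: "('x \<Rightarrow> bool) set"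
    assume "B \<in> {{f. f i \<in> A} | (i::'x) A. A \<in> sets (borel :: bool measure)}"
    then obtain i A where B: "B = {f. f i \<in> A}" by auto
    have occ: "all_occupied {i} \<in> sigma_sets UNIV ?E" by (rule sigma_sets.Basic) auto
    have "B = (if True \<in> A then all_occupied {i} else {}) \<union> (if False \<in> A then UNIV - all_occupied {i} else {})"
      unfolding B all_occupied_def by (auto split: if_splits) (metis (full_types))+
    then show "B \<in> sigma_sets UNIV ?E" using occ by auto
  next
    interpret sigma_algebra "UNIV :: ('x \<Rightarrow> bool) set"
      "sigma_sets UNIV {{f. f i \<in> A} | (i::'x) A. A \<in> sets (borel :: bool measure)}"
      by (rule sigma_algebra_sigma_sets) auto
    fix B :: "('x \<Rightarrow> bool) set" assume "B \<in> ?E"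
    then obtain X where X: "finite X" "B = all_occupied X" by auto
    have "(\<Inter>x\<in>X. {f. f x \<in> {True}}) \<in> sigma_sets UNIV {{f. f i \<in> A} | (i::'x) A. A \<in> sets (borel :: bool measure)}"
      if "X \<noteq> {}"
      by (rule finite_INT[OF X(1) that]) (auto intro!: sigma_sets.Basic exI)
    moreover have "B = (if X = {} then UNIV else (\<Inter>x\<in>X. {f. f x \<in> {True}}))"
      using X by (auto simp: all_occupied_def)
    ultimately show "B \<in> sigma_sets UNIV {{f. f i \<in> A} | (i::'x) A. A \<in> sets (borel :: bool measure)}"
      using top by auto
  qed
  finally show ?thesis .
qed

lemma all_occupied_sets [measurable]: "finite X \<Longrightarrow> all_occupied (X :: 'x::countable set) \<in> sets borel"
  unfolding sets_borel_config by (rule sigma_sets.Basic) auto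

lemma point_process_eqI:
  fixes M N :: "('x::countable \<Rightarrow> bool) measure"
  assumes M: "point_process M" and N: "point_process N"
    and eq: "\<And>X. finite X \<Longrightarrow> measure M (all_occupied X) = measure N (all_occupied X)"
  shows "M = N"
proof (rule measure_eqI_generator_eq[where \<Omega>=UNIV and E="{all_occupied X | X. finite X}" and A="\<lambda>_. all_occupied {}"])
  interpret M: prob_space M using M by (simp add: point_process_def)
  interpret N: prob_space N using N by (simp add: point_process_def)
  show "Int_stable {all_occupied (X :: 'x set) | X. finite X}"
  proof (rule Int_stableI)
    fix A B :: "('x \<Rightarrow> bool) set"
    assume "A \<in> {all_occupied X | X. finite X}" "B \<in> {all_occupied X | X. finite X}"
    then obtain X Y where "finite X" "A = all_occupied X" "finite Y" "B = all_occupied Y" by auto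
    then have "A \<inter> B = all_occupied (X \<union> Y)" "finite (X \<union> Y)" by (auto simp: all_occupied_def)
    then show "A \<inter> B \<in> {all_occupied X | X. finite X}" by blast
  qed
  show "emeasure M A = emeasure N A" if "A \<in> {all_occupied X | X. finite X}" for A
    using that eq by (auto simp: M.emeasure_eq_measure N.emeasure_eq_measure)
  show "sets M = sigma_sets UNIV {all_occupied X | X. finite X}"
    "sets N = sigma_sets UNIV {all_occupied X | X. finite X}"
    using M N by (simp_all add: point_process_def sets_borel_config)
  show "emeasure M (all_occupied {}) \<noteq> \<infinity>"
    by (simp add: M.emeasure_eq_measure)
qed (auto simp: all_occupied_def)

text \<open>
  The law of the set of occupied sites inside a finite window \<open>J\<close>.  Its weights sum to \<open>\<rho> {} = 1\<close>, since
  refining the sure event by all configurations in \<open>J\<close> preserves the total mass.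
\<close>

lemma occupation_pmf_exists:
  fixes \<rho> :: "'x set \<Rightarrow> real"
  assumes \<rho>1: "\<rho> {} = 1"
    and nonneg: "\<And>X Y. finite X \<Longrightarrow> finite Y \<Longrightarrow> X \<inter> Y = {} \<Longrightarrow> 0 \<le> incl_excl \<rho> X Y"
    and J: "finite J"
  obtains q :: "'x set pmf" where "\<And>X. pmf q X = (if X \<subseteq> J then incl_excl \<rho> X (J - X) else 0)"
proof
  let ?w = "\<lambda>X. if X \<subseteq> J then incl_excl \<rho> X (J - X) else 0"
  have w0: "0 \<le> ?w X" for X
    using J finite_subset[of X J] by (auto intro!: nonneg)
  have "(\<integral>\<^sup>+X. ennreal (?w X) \<partial>count_space UNIV) = (\<Sum>X\<in>Pow J. ennreal (?w X))"
    using J by (intro nn_integral_count_space') auto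
  also have "\<dots> = ennreal (\<Sum>X\<in>Pow J. ?w X)" by (rule sum_ennreal) (rule w0)
  also have "(\<Sum>X\<in>Pow J. ?w X) = (\<Sum>X\<in>Pow J. incl_excl \<rho> ({} \<union> X) ({} \<union> (J - X)))"
    by (rule sum.cong) auto
  also have "\<dots> = 1" using incl_excl_refine[OF J, of "{}" \<rho> "{}"] \<rho>1 by simp
  finally show "pmf (embed_pmf ?w) X = ?w X" for X
    by (intro pmf_embed_pmf w0) simp
qed

text \<open>
  Kolmogorov's extension theorem for occupation numbers.  The extension theorem is applied to
  processes with values \<open>0\<close> and \<open>1\<close> in the reals, a Polish space, and the result is then transported to the
  configuration space.
\<close>

lemma point_process_of_correlations:
  fixes \<rho> :: "'x::countable set \<Rightarrow> real"
  assumes \<rho>1: "\<rho> {} = 1"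
    and nonneg: "\<And>X Y. finite X \<Longrightarrow> finite Y \<Longrightarrow> X \<inter> Y = {} \<Longrightarrow> 0 \<le> incl_excl \<rho> X Y"
  shows "\<exists>M :: ('x \<Rightarrow> bool) measure.
    point_process M \<and> (\<forall>X. finite X \<longrightarrow> measure M (all_occupied X) = \<rho> X)"
proof -
  have "\<forall>J. \<exists>q. finite J \<longrightarrow> (\<forall>X. pmf q X = (if X \<subseteq> J then incl_excl \<rho> X (J - X) else 0))"
    using occupation_pmf_exists[OF \<rho>1 nonneg] by metis
  then obtain q where q: "\<And>J X. finite J \<Longrightarrow> pmf (q J) X = (if X \<subseteq> J then incl_excl \<rho> X (J - X) else 0)"
    by metis
  have restrict_q: "map_pmf (\<lambda>X. X \<inter> J) (q H) = q J" if JH: "J \<subseteq> H" and H: "finite H" for J H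
  proof (rule pmf_eqI)
    fix X
    have J: "finite J" using that finite_subset by blast
    define B where "B = {X'. X' \<subseteq> H \<and> X' \<inter> J = X}"
    have B: "finite B" unfolding B_def using H by auto
    have "pmf (map_pmf (\<lambda>X. X \<inter> J) (q H)) X = measure (q H) B"
      unfolding pmf_map by (rule measure_prob_cong_0) (auto simp: B_def q[OF H])
    also have "\<dots> = (\<Sum>X'\<in>B. incl_excl \<rho> X' (H - X'))"
      using B by (auto simp: measure_measure_pmf_finite q[OF H] B_def intro!: sum.cong)
    also have "\<dots> = pmf (q J) X"
    proof (cases "X \<subseteq> J")
      case True
      have "(\<Sum>X'\<in>B. incl_excl \<rho> X' (H - X')) =
         (\<Sum>Z\<in>Pow (H - J). incl_excl \<rho> (X \<union> Z) ((J - X) \<union> ((H - J) - Z)))"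
        by (rule sum.reindex_bij_witness[where i="\<lambda>Z. X \<union> Z" and j="\<lambda>X'. X' - J"])
          (use True JH in \<open>auto simp: B_def intro!: arg_cong2[where f="incl_excl \<rho>"]\<close>)
      also have "\<dots> = incl_excl \<rho> X (J - X)"
        by (rule incl_excl_refine) (use H J in auto)
      finally show ?thesis using True q[OF J] by simp
    next
      case False
      then have "B = {}" by (auto simp: B_def)
      then show ?thesis using False q[OF J] by simp
    qed
    finally show "pmf (map_pmf (\<lambda>X. X \<inter> J) (q H)) X = pmf (q J) X" .
  qed
  define ind :: "'x set \<Rightarrow> 'x set \<Rightarrow> 'x \<Rightarrow> real" where "ind J X = (\<lambda>i\<in>J. of_bool (i \<in> X))" for J X
  define P where "P J = distr (q J) (\<Pi>\<^sub>M i\<in>J. borel) (ind J)" for J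
  have ind_space: "ind J X \<in> space (\<Pi>\<^sub>M i\<in>J. borel)" for J X
    by (simp add: ind_def space_PiM)
  interpret polish_projective UNIV P
  proof (intro polish_projective.intro projective_family.intro)
    fix J H :: "'x set" assume JH: "J \<subseteq> H" "finite H"
    have "distr (P H) (\<Pi>\<^sub>M i\<in>J. borel) (\<lambda>f. restrict f J) =
        distr (q H) (\<Pi>\<^sub>M i\<in>J. borel) ((\<lambda>f. restrict f J) \<circ> ind H)"
      unfolding P_def by (rule distr_distr) (auto simp: ind_space intro!: measurable_restrict_subset JH)
    also have "(\<lambda>f. restrict f J) \<circ> ind H = ind J \<circ> (\<lambda>X. X \<inter> J)"
      using JH by (auto simp: fun_eq_iff ind_def)
    also have "distr (q H) (\<Pi>\<^sub>M i\<in>J. borel) (ind J \<circ> (\<lambda>X. X \<inter> J)) =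
        distr (map_pmf (\<lambda>X. X \<inter> J) (q H)) (\<Pi>\<^sub>M i\<in>J. borel) (ind J)"
      unfolding map_pmf_rep_eq by (rule distr_distr[symmetric]) (auto simp: ind_space)
    also have "\<dots> = P J" unfolding restrict_q[OF JH] P_def ..
    finally show "P J = distr (P H) (\<Pi>\<^sub>M i\<in>J. borel) (\<lambda>f. restrict f J)" by (rule sym)
  next
    fix J :: "'x set"
    show "prob_space (P J)"
      unfolding P_def by (rule measure_pmf.prob_space_distr) (simp add: ind_space)
  qed
  define \<Phi> :: "('x \<Rightarrow> real) \<Rightarrow> 'x \<Rightarrow> bool" where "\<Phi> f = (\<lambda>x. f x = 1)" for f
  have sets_lim: "sets lim = sets (\<Pi>\<^sub>M i\<in>(UNIV::'x set). (borel :: real measure))" by simp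
  have "\<Phi> \<in> lim \<rightarrow>\<^sub>M (\<Pi>\<^sub>M i\<in>(UNIV::'x set). (borel :: bool measure))"
  proof (rule measurable_PiM_single')
    fix i :: 'x
    have "(\<lambda>f. f i = (1::real)) \<in> (\<Pi>\<^sub>M i\<in>(UNIV::'x set). (borel :: real measure)) \<rightarrow>\<^sub>M count_space UNIV"
      by measurable
    then have "(\<lambda>f. f i = (1::real)) \<in> (\<Pi>\<^sub>M i\<in>(UNIV::'x set). (borel :: real measure)) \<rightarrow>\<^sub>M (borel :: bool measure)"
      by (rule measurable_compose) simp
    then show "(\<lambda>f. \<Phi> f i) \<in> lim \<rightarrow>\<^sub>M (borel :: bool measure)"
      unfolding \<Phi>_def using measurable_cong_sets[OF sets_lim refl] by blast
  qed simp
  then have \<Phi>: "\<Phi> \<in> lim \<rightarrow>\<^sub>M borel"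
    using measurable_cong_sets[OF refl sets_PiM_equal_borel] by blast
  define M where "M = distr lim borel \<Phi>"
  show ?thesis
  proof (intro exI[of _ M] conjI allI impI)
    show "point_process M"
      unfolding point_process_def M_def using P.prob_space_distr[OF \<Phi>] by simp
    fix X :: "'x set" assume X: "finite X"
    define A :: "('x \<Rightarrow> real) set" where "A = {g \<in> space (\<Pi>\<^sub>M i\<in>X. borel). \<forall>x\<in>X. g x = 1}"
    have A: "A \<in> sets (\<Pi>\<^sub>M i\<in>X. borel)"
      unfolding A_def using X by measurable
    have "measure M (all_occupied X) = measure lim (\<Phi> -` all_occupied X \<inter> space lim)"
      unfolding M_def using X by (intro measure_distr \<Phi> all_occupied_sets)
    also have "\<Phi> -` all_occupied X \<inter> space lim = emb UNIV X A"
      by (auto simp: \<Phi>_def all_occupied_def A_def prod_emb_iff space_PiM)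
    also have "measure lim \<dots> = measure (P X) A"
      using X A by (intro measure_lim_emb) auto
    also have "\<dots> = measure (q X) (ind X -` A \<inter> space (q X))"
      unfolding P_def using A by (intro measure_distr) (auto simp: ind_space)
    also have "\<dots> = measure (q X) {X}"
      by (rule measure_prob_cong_0) (auto simp: q[OF X] A_def ind_space, auto simp: ind_def)
    also have "\<dots> = \<rho> X" using q[OF X, of X] by (simp add: measure_pmf_single)
    finally show "measure M (all_occupied X) = \<rho> X" .
  qed
qed

section \<open>Integrals of multiplicative functionals of a point process\<close>

lemma Psi_expand:
  assumes F: "finite {x. \<alpha> x \<noteq> 1}"
  shows "Psi \<alpha> \<omega> = (\<Sum>X\<in>Pow {x. \<alpha> x \<noteq> 1}. (\<Prod>x\<in>X. \<alpha> x - 1) * indicator (all_occupied X) \<omega>)"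
proof -
  let ?F = "{x. \<alpha> x \<noteq> 1}"
  have "Psi \<alpha> \<omega> = (\<Prod>x\<in>?F. (\<alpha> x - 1) * of_bool (\<omega> x) + 1)"
    unfolding Psi_def by (rule prod.mono_neutral_cong_left) (use F in auto)
  also have "\<dots> = (\<Sum>X\<in>Pow ?F. (\<Prod>x\<in>X. (\<alpha> x - 1) * of_bool (\<omega> x)) * (\<Prod>x\<in>?F - X. 1))"
    by (rule prod_add[OF F])
  also have "\<dots> = (\<Sum>X\<in>Pow ?F. (\<Prod>x\<in>X. \<alpha> x - 1) * indicator (all_occupied X) \<omega>)"
  proof (rule sum.cong[OF refl])
    fix X assume "X \<in> Pow ?F"
    then have "finite X" using F finite_subset by auto
    then have "(\<Prod>x\<in>X. of_bool (\<omega> x)) = (indicator (all_occupied X) \<omega> :: real)"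
      by (induction X rule: finite_induct) (auto simp: all_occupied_def indicator_def)
    then show "(\<Prod>x\<in>X. (\<alpha> x - 1) * of_bool (\<omega> x)) * (\<Prod>x\<in>?F - X. 1) =
        (\<Prod>x\<in>X. \<alpha> x - 1) * indicator (all_occupied X) \<omega>"
      by (simp add: prod.distrib)
  qed
  finally show ?thesis .
qed

lemma integral_Psi:
  fixes M :: "('x::countable \<Rightarrow> bool) measure"
  assumes M: "point_process M" and F: "finite {x. \<alpha> x \<noteq> 1}"
  shows "(\<integral>\<omega>. Psi \<alpha> \<omega> \<partial>M) = (\<Sum>X\<in>Pow {x. \<alpha> x \<noteq> 1}. (\<Prod>x\<in>X. \<alpha> x - 1) * measure M (all_occupied X))"
proof -
  interpret prob_space M using M by (simp add: point_process_def)
  have sets: "all_occupied X \<in> sets M" if "X \<in> Pow {x. \<alpha> x \<noteq> 1}" for X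
    using that M F finite_subset by (auto simp: point_process_def intro!: all_occupied_sets)
  have space: "space M = UNIV" using M sets_eq_imp_space_eq[of M borel] by (simp add: point_process_def)
  have "(\<integral>\<omega>. (\<Prod>x\<in>X. \<alpha> x - 1) * indicator (all_occupied X) \<omega> \<partial>M) =
      (\<Prod>x\<in>X. \<alpha> x - 1) * measure M (all_occupied X)" for X
    by (simp add: space)
  moreover have "integrable M (\<lambda>\<omega>. (\<Prod>x\<in>X. \<alpha> x - 1) * indicator (all_occupied X) \<omega>)"
    if "X \<in> Pow {x. \<alpha> x \<noteq> 1}" for X
    using sets[OF that] by (simp add: emeasure_eq_measure)
  ultimately show ?thesis
    unfolding Psi_expand[OF F] by (simp only: Bochner_Integration.integral_sum)
qed

text \<open>
  For the function \<open>\<alpha>\<close> that equals \<open>2\<close> on \<open>F\<close> and \<open>1\<close> elsewhere, the integral is the sum of the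
  correlations over all subsets of \<open>F\<close>, in which \<open>F\<close> itself is the only set that is not covered by the
  induction hypothesis.
\<close>

lemma correlations_determined_by_Psi:
  fixes M N :: "('x::countable \<Rightarrow> bool) measure"
  assumes M: "point_process M" and N: "point_process N"
    and eq: "\<And>\<alpha> :: 'x \<Rightarrow> real. (\<forall>x. \<alpha> x \<ge> 1) \<Longrightarrow> finite {x. \<alpha> x \<noteq> 1} \<Longrightarrow>
      (\<integral>\<omega>. Psi \<alpha> \<omega> \<partial>M) = (\<integral>\<omega>. Psi \<alpha> \<omega> \<partial>N)"
    and "finite F"
  shows "measure M (all_occupied F) = measure N (all_occupied F)"
  using \<open>finite F\<close>
proof (induction F rule: finite_psubset_induct)
  case (psubset F)
  define \<alpha> :: "'x \<Rightarrow> real" where "\<alpha> x = (if x \<in> F then 2 else 1)" for x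
  have F: "{x. \<alpha> x \<noteq> 1} = F" by (auto simp: \<alpha>_def)
  have one: "(\<Prod>x\<in>X. \<alpha> x - 1) = 1" if "X \<in> Pow F" for X
    using that by (intro prod.neutral) (auto simp: \<alpha>_def)
  have int: "(\<integral>\<omega>. Psi \<alpha> \<omega> \<partial>L) = measure L (all_occupied F) + (\<Sum>X\<in>Pow F - {F}. measure L (all_occupied X))"
    if "point_process L" for L
  proof -
    have "(\<integral>\<omega>. Psi \<alpha> \<omega> \<partial>L) = (\<Sum>X\<in>Pow F. (\<Prod>x\<in>X. \<alpha> x - 1) * measure L (all_occupied X))"
      using integral_Psi[OF that, of \<alpha>] F \<open>finite F\<close> by simp
    also have "\<dots> = (\<Sum>X\<in>Pow F. measure L (all_occupied X))"
      by (rule sum.cong) (simp_all add: one)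
    finally show ?thesis using \<open>finite F\<close> by (simp add: sum.remove[of "Pow F" F])
  qed
  have "(\<integral>\<omega>. Psi \<alpha> \<omega> \<partial>M) = (\<integral>\<omega>. Psi \<alpha> \<omega> \<partial>N)"
    by (rule eq) (use F \<open>finite F\<close> in \<open>auto simp: \<alpha>_def\<close>)
  moreover have "(\<Sum>X\<in>Pow F - {F}. measure M (all_occupied X)) = (\<Sum>X\<in>Pow F - {F}. measure N (all_occupied X))"
    by (rule sum.cong[OF refl]) (use psubset.IH in auto)
  ultimately show ?case using int[OF M] int[OF N] by simp
qed

section \<open>The kernel of a covariance operator\<close>

definition unit_vec :: "'x \<times> bool \<Rightarrow> 'x dbl" where
  "unit_vec i = (if snd i then (0, basis_vec (fst i)) else (basis_vec (fst i), 0))"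

definition coord :: "'x dbl \<Rightarrow> 'x \<times> bool \<Rightarrow> complex" where
  "coord u i = (if snd i then snd u else fst u) (fst i)"

definition finite_vec :: "('x \<times> bool) set \<Rightarrow> ('x \<times> bool \<Rightarrow> complex) \<Rightarrow> 'x dbl" where
  "finite_vec I u = (\<lambda>x. if (x, False) \<in> I then u (x, False) else 0, \<lambda>x. if (x, True) \<in> I then u (x, True) else 0)"

lemma coord_simps [simp]:
  "coord (u + v) i = coord u i + coord v i"
  "coord (u - v) i = coord u i - coord v i"
  "coord (hilb_scale c u) i = c * coord u i"
  "coord (Gam u) i = cnj (coord u (flip i))"
  "coord (unit_vec j) i = of_bool (i = j)"
  "coord (finite_vec I w) i = (if i \<in> I then w i else 0)"
proof -
  show "coord (u + v) i = coord u i + coord v i" "coord (u - v) i = coord u i - coord v i"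
    "coord (hilb_scale c u) i = c * coord u i" "coord (Gam u) i = cnj (coord u (flip i))"
    by (simp_all add: coord_def hilb_scale_def Gam_def conj_J_def flip_def)
  obtain x a y b where ij: "i = (x, a)" "j = (y, b)" by (cases i, cases j)
  show "coord (unit_vec j) i = of_bool (i = j)"
    unfolding ij by (cases a; cases b) (simp_all add: coord_def unit_vec_def basis_vec_def)
  show "coord (finite_vec I w) i = (if i \<in> I then w i else 0)"
    unfolding ij by (cases a) (simp_all add: coord_def finite_vec_def)
qed

lemma coord_eqI: "(\<And>i. coord u i = coord v i) \<Longrightarrow> u = v"
proof -
  assume h: "\<And>i. coord u i = coord v i"
  have "fst u x = fst v x" "snd u x = snd v x" for x
    using h[of "(x, False)"] h[of "(x, True)"] by (auto simp: coord_def)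
  then show "u = v" by (simp add: prod_eq_iff fun_eq_iff)
qed

lemma ell2_inner_finite:
  assumes "finite F" "\<And>x. x \<notin> F \<Longrightarrow> cnj (f x) * g x = 0"
  shows "ell2_inner f g = (\<Sum>x\<in>F. cnj (f x) * g x)"
proof -
  have "ell2_inner f g = (\<Sum>\<^sub>\<infinity>x\<in>F. cnj (f x) * g x)"
    unfolding ell2_inner_def by (rule infsum_cong_neutral) (use assms(2) in auto)
  then show ?thesis using assms(1) by simp
qed

lemma basis_vec_apply: "basis_vec x y = of_bool (y = x)"
  by (simp add: basis_vec_def)

lemma ell2_inner_basis_vec:
  "ell2_inner (basis_vec x) f = f x" "ell2_inner f (basis_vec x) = cnj (f x)"
  by (subst ell2_inner_finite[of "{x}"]; auto simp: basis_vec_def)+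

lemma ell2_inner_0: "ell2_inner 0 f = 0" "ell2_inner f 0 = 0"
  by (subst ell2_inner_finite[of "{}"]; simp)+

lemma hilb_inner_unit_vec:
  "hilb_inner (unit_vec i) v = coord v i" "hilb_inner v (unit_vec i) = cnj (coord v i)"
  by (cases i; auto simp: hilb_inner_def unit_vec_def coord_def ell2_inner_basis_vec ell2_inner_0)+

lemma hilb_inner_finite_vec:
  assumes "finite \<Lambda>"
  shows "hilb_inner (finite_vec (\<Lambda> \<times> UNIV) u) v = (\<Sum>i\<in>\<Lambda> \<times> UNIV. cnj (u i) * coord v i)"
proof -
  have "hilb_inner (finite_vec (\<Lambda> \<times> UNIV) u) v =
     (\<Sum>x\<in>\<Lambda>. cnj (u (x, False)) * fst v x) + (\<Sum>x\<in>\<Lambda>. cnj (u (x, True)) * snd v x)"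
    unfolding hilb_inner_def finite_vec_def
    by (simp add: ell2_inner_finite[OF assms] cong: sum.cong)
  also have "\<dots> = (\<Sum>x\<in>\<Lambda>. \<Sum>b\<in>UNIV. cnj (u (x, b)) * coord v (x, b))"
    by (simp add: sum.distrib[symmetric] UNIV_bool coord_def add.commute)
  finally show ?thesis by (simp add: sum.cartesian_product)
qed

lemma finite_support_ell2:
  assumes "finite F" "\<And>x. x \<notin> F \<Longrightarrow> f x = 0"
  shows "f \<in> ell2"
proof -
  have "(\<lambda>x. (cmod (f x))\<^sup>2) summable_on F" using assms(1) by simp
  then have "(\<lambda>x. (cmod (f x))\<^sup>2) summable_on UNIV"
    using assms(2) by (subst summable_on_cong_neutral[where T=F]) auto
  then show ?thesis by (simp add: ell2_def)
qed

lemma finite_vec_hilb [simp]: 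
  assumes "finite I"
  shows "finite_vec I u \<in> hilb"
proof -
  have "finite (fst ` I)" using assms by simp
  moreover have "(x, b) \<notin> I" if "x \<notin> fst ` I" for x b using that by force
  ultimately show ?thesis
    unfolding hilb_def finite_vec_def
    by (auto intro!: finite_support_ell2[of "fst ` I"])
qed

lemma unit_vec_eq_finite_vec: "unit_vec i = finite_vec {i} (\<lambda>_. 1)"
  by (rule coord_eqI) simp

lemma unit_vec_hilb [simp]: "unit_vec i \<in> hilb"
  by (simp add: unit_vec_eq_finite_vec)

definition operator_matrix :: "('x dbl \<Rightarrow> 'x dbl) \<Rightarrow> 'x \<times> bool \<Rightarrow> 'x \<times> bool \<Rightarrow> complex" where
  "operator_matrix S i j = coord (S (unit_vec j)) i"

text \<open>
  On finitely supported vectors the operator acts through its matrix; this turns \<open>0 \<le> S\<close> into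
  positivity of the finite sections of the matrix.
\<close>

lemma coord_operator_finite_vec:
  assumes S: "bounded_operator S" and "finite I"
  shows "coord (S (finite_vec I u)) i = (\<Sum>j\<in>I. u j * operator_matrix S i j)"
  using assms(2)
proof (induction I rule: finite_induct)
  case empty
  have "finite_vec {} u = hilb_scale 0 (finite_vec {} u)" by (rule coord_eqI) simp
  then have "S (finite_vec {} u) = hilb_scale 0 (S (finite_vec {} u))"
    using S unfolding bounded_operator_def by (metis finite.emptyI finite_vec_hilb)
  then have "coord (S (finite_vec {} u)) i = 0 * coord (S (finite_vec {} u)) i"
    by (metis coord_simps(3))
  then show ?case by simp
next
  case (insert j I)
  have s: "hilb_scale (u j) (unit_vec j) = finite_vec {j} u" by (rule coord_eqI) simp
  have "finite_vec (insert j I) u = finite_vec I u + hilb_scale (u j) (unit_vec j)"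
    by (rule coord_eqI) (use insert.hyps in auto)
  then have "S (finite_vec (insert j I) u) = S (finite_vec I u) + S (hilb_scale (u j) (unit_vec j))"
    using S insert.hyps(1) unfolding s bounded_operator_def by simp
  also have "S (hilb_scale (u j) (unit_vec j)) = hilb_scale (u j) (S (unit_vec j))"
    using S unfolding bounded_operator_def by simp
  finally show ?case using insert by (simp add: operator_matrix_def)
qed

lemma scalar_kernel_of:
  "scalar_kernel (kernel_of S) i j = operator_matrix S (flip i) j - of_bool (snd i \<and> j = flip i)"
proof -
  obtain x a y b where ij: "i = (x, a)" "j = (y, b)" by (cases i, cases j)
  show ?thesis unfolding ij
    by (cases a; cases b) (auto simp: scalar_kernel_def kernel_of_def operator_matrix_def flip_def
      ell2_inner_basis_vec coord_def unit_vec_def blk11_def blk12_def blk21_def blk22_def basis_vec_apply)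
qed

lemma flip_flip [simp]: "flip (flip i) = i" "flip i = flip j \<longleftrightarrow> i = j"
  by (auto simp: flip_def prod_eq_iff)

context
  fixes S :: "'x dbl \<Rightarrow> 'x dbl"
  assumes S: "S \<in> covariances"
begin

lemma operator_matrix_hermitian: "operator_matrix S j i = cnj (operator_matrix S i j)"
proof -
  have "hilb_inner (S (unit_vec i)) (unit_vec j) = hilb_inner (unit_vec i) (S (unit_vec j))"
    using S by (simp add: covariances_def self_adjoint_def)
  then have "cnj (operator_matrix S j i) = operator_matrix S i j"
    by (simp add: hilb_inner_unit_vec operator_matrix_def)
  then show ?thesis by (metis complex_cnj_cnj)
qed

lemma operator_matrix_bar:
  "cnj (operator_matrix S (flip i) (flip j)) = of_bool (i = j) - operator_matrix S i j"
proof -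
  have "Gam (unit_vec j) = unit_vec (flip j)"
    by (rule coord_eqI) (auto simp: flip_def prod_eq_iff)
  moreover have "bar S (unit_vec j) = unit_vec j - S (unit_vec j)"
    using S by (simp add: covariances_def)
  ultimately have "coord (Gam (S (unit_vec (flip j)))) i = coord (unit_vec j - S (unit_vec j)) i"
    by (simp add: bar_def)
  then show ?thesis by (simp add: operator_matrix_def)
qed

text \<open>
  The relation \<open>\<Gamma> S \<Gamma> = 1 - S\<close> of matrices, combined with Hermitian symmetry to remove the complex conjugation.
\<close>

lemma scalar_kernel_skew:
  "scalar_kernel (kernel_of S) j i = - scalar_kernel (kernel_of S) i j"
proof -
  have "operator_matrix S (flip j) i = cnj (operator_matrix S (flip (flip i)) (flip j))"
    by (simp add: operator_matrix_hermitian[of "flip j" i])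
  also have "\<dots> = of_bool (flip i = j) - operator_matrix S (flip i) j"
    by (rule operator_matrix_bar)
  finally show ?thesis by (cases i; cases j) (auto simp: scalar_kernel_of flip_def)
qed

lemma pos_semidef_operator_matrix:
  assumes "finite \<Lambda>"
  shows "pos_semidef (\<Lambda> \<times> UNIV) (operator_matrix S)"
  unfolding pos_semidef_def
proof (intro conjI ballI allI)
  show "operator_matrix S j i = cnj (operator_matrix S i j)" for i j
    by (rule operator_matrix_hermitian)
  fix u :: "'x \<times> bool \<Rightarrow> complex"
  let ?I = "\<Lambda> \<times> (UNIV :: bool set)"
  define v where "v = finite_vec ?I u"
  have fin: "finite ?I" using assms by simp
  have b: "bounded_operator S" using S by (simp add: covariances_def)
  have "v \<in> hilb" unfolding v_def using fin by (rule finite_vec_hilb)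
  then have "hilb_inner v (S v - 0) \<in> \<real>\<^sub>\<ge>\<^sub>0"
    using S by (simp add: covariances_def operator_le_def)
  moreover have "hilb_inner v (S v - 0) = (\<Sum>i\<in>?I. \<Sum>j\<in>?I. cnj (u i) * operator_matrix S i j * u j)"
    unfolding v_def diff_zero hilb_inner_finite_vec[OF assms] coord_operator_finite_vec[OF b fin]
      sum_distrib_left
    by (intro sum.cong refl) (simp only: mult_ac)
  ultimately show "0 \<le> Re (\<Sum>i\<in>?I. \<Sum>j\<in>?I. cnj (u i) * operator_matrix S i j * u j)"
    by (simp only: complex_nonneg_Reals_iff)
qed

lemma covariance_kernel_of:
  assumes "finite \<Lambda>"
  shows "covariance_kernel \<Lambda> (scalar_kernel (kernel_of S))"
proof (rule covariance_kernelI)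
  show "scalar_kernel (kernel_of S) j i = - scalar_kernel (kernel_of S) i j" for i j
    by (rule scalar_kernel_skew)
  have "covariance_matrix (scalar_kernel (kernel_of S)) = operator_matrix S"
    by (auto simp: fun_eq_iff covariance_matrix_def scalar_kernel_of flip_def)
  then show "pos_semidef (\<Lambda> \<times> UNIV) (covariance_matrix (scalar_kernel (kernel_of S)))"
    using pos_semidef_operator_matrix[OF assms] by simp
qed

lemma antisymmetric_kernel_of: "antisymmetric_kernel (kernel_of S)"
  unfolding antisymmetric_kernel_def
proof (intro allI)
  fix x y :: 'x
  have "kernel_of S y x $ (if b then 2 else 1) $ (if a then 2 else 1) =
     - kernel_of S x y $ (if a then 2 else 1) $ (if b then 2 else 1)" for a b
    using scalar_kernel_skew[of "(y, b)" "(x, a)"] by (simp add: scalar_kernel_def)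
  from this[of False False] this[of False True] this[of True False] this[of True True]
  show "Finite_Cartesian_Product.transpose (kernel_of S x y) = - kernel_of S y x"
    by (simp add: vec_eq_iff forall_2 Finite_Cartesian_Product.transpose_def)
qed

end

section \<open>The Fredholm Pfaffian\<close>

lemma pf_set_sandwich:
  assumes "finite X" "\<And>x. \<alpha> x \<ge> 1"
  shows "pf_set (sandwich \<alpha> K) X = of_real (\<Prod>x\<in>X. \<alpha> x - 1) * pf_set K X"
proof -
  obtain xs where xs: "distinct xs" "set xs = X" using finite_distinct_list[OF assms(1)] by blast
  define s where "s x = complex_of_real (sqrt (\<alpha> x - 1))" for x
  have "scalar_kernel (sandwich \<alpha> K) = (\<lambda>i j. s (fst i) * s (fst j) * scalar_kernel K i j)"
    by (auto simp: fun_eq_iff scalar_kernel_def sandwich_def s_def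
      scaleR_conv_of_real[where 'a=complex])
  then have "pf (scalar_kernel (sandwich \<alpha> K)) xs = (\<Prod>x\<in>set xs. (s x)\<^sup>2) * pf (scalar_kernel K) xs"
    using pf_scale[OF xs(1)] by simp
  moreover have "(s x)\<^sup>2 = of_real (\<alpha> x - 1)" for x
    using assms(2)[of x] unfolding s_def of_real_power[symmetric] by simp
  ultimately show ?thesis
    by (simp add: pf_set_eq_pf_on pf_on_set[OF xs(1), unfolded xs(2)] xs(2))
qed

text \<open>
  A set containing a point with \<open>\<alpha> = 1\<close> contributes nothing, and the leading \<open>1\<close> of the Fredholm
  Pfaffian is the term of the empty set.
\<close>

lemma fredholm_pfaffian_sandwich:
  assumes F: "finite {x. \<alpha> x \<noteq> 1}" and "\<And>x. \<alpha> x \<ge> 1"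
  shows "fredholm_pfaffian (sandwich \<alpha> K) =
    (\<Sum>X\<in>Pow {x. \<alpha> x \<noteq> 1}. of_real (\<Prod>x\<in>X. \<alpha> x - 1) * pf_set K X)"
proof -
  let ?F = "{x. \<alpha> x \<noteq> 1}"
  have "(\<Sum>\<^sub>\<infinity>X\<in>{X. finite X \<and> X \<noteq> {}}. pf_set (sandwich \<alpha> K) X) =
     (\<Sum>\<^sub>\<infinity>X\<in>Pow ?F - {{}}. of_real (\<Prod>x\<in>X. \<alpha> x - 1) * pf_set K X)"
  proof (rule infsum_cong_neutral)
    fix X assume "X \<in> (Pow ?F - {{}}) - {X. finite X \<and> X \<noteq> {}}"
    then show "of_real (\<Prod>x\<in>X. \<alpha> x - 1) * pf_set K X = 0"
      using F finite_subset by auto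
  next
    fix X assume X: "X \<in> {X. finite X \<and> X \<noteq> {}} - (Pow ?F - {{}})"
    then obtain x where "x \<in> X" "\<alpha> x = 1" by auto
    then have "(\<Prod>x\<in>X. \<alpha> x - 1) = 0" using X by auto
    then show "pf_set (sandwich \<alpha> K) X = 0" using X assms(2) by (simp add: pf_set_sandwich)
  next
    fix X assume "X \<in> {X. finite X \<and> X \<noteq> {}} \<inter> (Pow ?F - {{}})"
    then show "pf_set (sandwich \<alpha> K) X = of_real (\<Prod>x\<in>X. \<alpha> x - 1) * pf_set K X"
      using assms(2) by (simp add: pf_set_sandwich)
  qed
  also have "\<dots> = (\<Sum>X\<in>Pow ?F - {{}}. of_real (\<Prod>x\<in>X. \<alpha> x - 1) * pf_set K X)"
    using F by simp
  finally have "fredholm_pfaffian (sandwich \<alpha> K) =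
      1 + (\<Sum>X\<in>Pow ?F - {{}}. of_real (\<Prod>x\<in>X. \<alpha> x - 1) * pf_set K X)"
    by (simp add: fredholm_pfaffian_def)
  moreover have "pf_set K {} = 1"
    using pf_on_set[of "[]" "scalar_kernel K"] by (simp add: pf_set_eq_pf_on)
  ultimately show ?thesis
    using F by (subst sum.remove[of _ "{}"]) auto
qed

section \<open>Existence and uniqueness\<close>

theorem proposition1p6:
  fixes S :: "('x::countable \<Rightarrow> complex) \<times> ('x \<Rightarrow> complex) \<Rightarrow> ('x \<Rightarrow> complex) \<times> ('x \<Rightarrow> complex)"
  assumes "S \<in> covariances"
  shows "\<exists>!M :: ('x \<Rightarrow> bool) measure. pfaffian_point_process M \<and>
    (\<forall>\<alpha> :: 'x \<Rightarrow> real. (\<forall>x. \<alpha> x \<ge> 1) \<and> finite {x. \<alpha> x \<noteq> 1} \<longrightarrow>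
      complex_of_real (\<integral>\<omega>. Psi \<alpha> \<omega> \<partial>M) = fredholm_pfaffian (sandwich \<alpha> (kernel_of S)))"
proof (rule ex_ex1I)
  let ?A = "scalar_kernel (kernel_of S)"
  define \<rho> where "\<rho> X = Re (pf_on ?A X)" for X
  have nonneg: "incl_excl (pf_on ?A) X Y \<in> \<real>\<^sub>\<ge>\<^sub>0" if "finite X" "finite Y" "X \<inter> Y = {}" for X Y
    using that by (intro incl_excl_pf_nonneg[of "X \<union> Y"] covariance_kernel_of assms) auto
  have \<rho>: "complex_of_real (\<rho> X) = pf_on ?A X" if "finite X" for X
    using nonneg[of X "{}"] that by (simp add: \<rho>_def complex_nonneg_Reals_iff complex_eq_iff)
  have "\<rho> {} = 1" using pf_on_set[of "[]" ?A] by (simp add: \<rho>_def)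
  moreover have "0 \<le> incl_excl \<rho> X Y" if XY: "finite X" "finite Y" "X \<inter> Y = {}" for X Y
  proof -
    have "complex_of_real (incl_excl \<rho> X Y) = incl_excl (pf_on ?A) X Y"
      unfolding incl_excl_def of_real_sum of_real_mult
    proof (rule sum.cong[OF refl])
      fix Z assume "Z \<in> Pow Y"
      then have "finite (X \<union> Z)" using XY finite_subset by auto
      then show "complex_of_real ((- 1) ^ card Z) * complex_of_real (\<rho> (X \<union> Z)) =
          (- 1) ^ card Z * pf_on ?A (X \<union> Z)"
        by (simp add: \<rho>)
    qed
    then have "complex_of_real (incl_excl \<rho> X Y) \<in> \<real>\<^sub>\<ge>\<^sub>0" using nonneg[OF XY] by simp
    then show ?thesis by simp
  qed
  ultimately have "\<exists>M :: ('x \<Rightarrow> bool) measure.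
      point_process M \<and> (\<forall>X. finite X \<longrightarrow> measure M (all_occupied X) = \<rho> X)"
    by (rule point_process_of_correlations)
  then obtain M :: "('x \<Rightarrow> bool) measure" where M: "point_process M"
    and corr: "\<And>X. finite X \<Longrightarrow> measure M (all_occupied X) = \<rho> X"
    by blast
  have "complex_of_real (correlation M xs) = pf_list (kernel_of S) xs" for xs
  proof (cases "distinct xs")
    case True
    then have "correlation M xs = \<rho> (set xs)"
      using corr[of "set xs"] by (simp add: correlation_def all_occupied_def)
    then show ?thesis using True \<rho>[of "set xs"] by (simp add: pf_on_set pf_list_eq_pf)
  next
    case False
    then show ?thesis by (simp add: correlation_def pf_list_eq_pf pf_not_distinct)
  qed
  then have "pfaffian_point_process M"
    unfolding pfaffian_point_process_def using M antisymmetric_kernel_of[OF assms] by blast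
  moreover have "complex_of_real (\<integral>\<omega>. Psi \<alpha> \<omega> \<partial>M) = fredholm_pfaffian (sandwich \<alpha> (kernel_of S))"
    if \<alpha>: "\<forall>x. \<alpha> x \<ge> 1" "finite {x. \<alpha> x \<noteq> 1}" for \<alpha> :: "'x \<Rightarrow> real"
  proof -
    have "complex_of_real (\<integral>\<omega>. Psi \<alpha> \<omega> \<partial>M) =
        (\<Sum>X\<in>Pow {x. \<alpha> x \<noteq> 1}. of_real (\<Prod>x\<in>X. \<alpha> x - 1) * pf_set (kernel_of S) X)"
      unfolding integral_Psi[OF M \<alpha>(2)] of_real_sum
    proof (rule sum.cong[OF refl])
      fix X assume "X \<in> Pow {x. \<alpha> x \<noteq> 1}"
      then have "finite X" using \<alpha>(2) finite_subset by auto
      then show "complex_of_real ((\<Prod>x\<in>X. \<alpha> x - 1) * measure M (all_occupied X)) =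
          of_real (\<Prod>x\<in>X. \<alpha> x - 1) * pf_set (kernel_of S) X"
        by (simp only: corr \<rho> of_real_mult pf_set_eq_pf_on)
    qed
    then show ?thesis using fredholm_pfaffian_sandwich[OF \<alpha>(2)] \<alpha>(1) by simp
  qed
  ultimately show "\<exists>M :: ('x \<Rightarrow> bool) measure. pfaffian_point_process M \<and>
    (\<forall>\<alpha> :: 'x \<Rightarrow> real. (\<forall>x. \<alpha> x \<ge> 1) \<and> finite {x. \<alpha> x \<noteq> 1} \<longrightarrow>
      complex_of_real (\<integral>\<omega>. Psi \<alpha> \<omega> \<partial>M) = fredholm_pfaffian (sandwich \<alpha> (kernel_of S)))"
    by blast
next
  fix M N :: "('x \<Rightarrow> bool) measure"
  assume M: "pfaffian_point_process M \<and> (\<forall>\<alpha> :: 'x \<Rightarrow> real. (\<forall>x. \<alpha> x \<ge> 1) \<and> finite {x. \<alpha> x \<noteq> 1} \<longrightarrow>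
      complex_of_real (\<integral>\<omega>. Psi \<alpha> \<omega> \<partial>M) = fredholm_pfaffian (sandwich \<alpha> (kernel_of S)))"
    and N: "pfaffian_point_process N \<and> (\<forall>\<alpha> :: 'x \<Rightarrow> real. (\<forall>x. \<alpha> x \<ge> 1) \<and> finite {x. \<alpha> x \<noteq> 1} \<longrightarrow>
      complex_of_real (\<integral>\<omega>. Psi \<alpha> \<omega> \<partial>N) = fredholm_pfaffian (sandwich \<alpha> (kernel_of S)))"
  have pp: "point_process M" "point_process N"
    using M N by (auto simp: pfaffian_point_process_def)
  have "(\<integral>\<omega>. Psi \<alpha> \<omega> \<partial>M) = (\<integral>\<omega>. Psi \<alpha> \<omega> \<partial>N)"
    if "\<forall>x. \<alpha> x \<ge> 1" "finite {x. \<alpha> x \<noteq> 1}" for \<alpha> :: "'x \<Rightarrow> real"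
    using M N that by (metis of_real_eq_iff)
  then show "M = N"
    by (intro point_process_eqI pp correlations_determined_by_Psi)
qed

end
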